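(* For every $k\ge1$, $$H^k_{W,V}(\mathbb{T})\subset C^{k-1}_{W,V}(\mathbb{T}),$$ i.e. every element of $H^k_{W,V}(\mathbb{T})$ is $V$-a.e. equal to an element of $C^{k-1}_{W,V}(\mathbb{T})$, where $C^0_{W,V}(\mathbb{T})=\{f:\mathbb{T}\to\mathbb{R}: f\text{ is càdlàg and } D(f)\subset D(W)\}$ and $D(g)$ denotes the set of discontinuity points of $g$.
   Context: $W,V:\mathbb{R}\to\mathbb{R}$ are strictly increasing, $W$ càdlàg, $V$ càglàd, $W(x+1)-W(x)=W(1)-W(0)$ and $V(x+1)-V(x)=V(1)-V(0)$ for all $x$, both are continuous at $0$ and $W(0)=V(0)=0$. $\mathbb{T}=\mathbb{R}/\mathbb{Z}$; $dW((a,b])=W(b)-W(a)$, $dV([a,b))=V(b)-V(a)$; $L^2_V(\mathbb{T}),L^2_W(\mathbb{T})$ are the corresponding $L^2$ spaces. Strong one-sided derivatives: $D^{-}_{W}f(x)=\lim_{h\to0^-}\frac{f(x+h)-f(x)}{W(x+h)-W(x)}$, $D^{+}_{V}g(x)=\lim_{h\to0^+}\frac{g(x+h)-g(x)}{V(x+h)-V(x)}$. $D^{(n)}_{W,V}$ is the alternating composition of $n$ derivatives with $D^-_W$ applied first ($D^-_W$, $D^+_VD^-_W$, $D^-_WD^+_VD^-_W$, ...). $C_0(\mathbb{T})$: càdlàg $f:\mathbb{T}\to\mathbb{R}$ with $\int f\,dV=0$; $C_1(\mathbb{T})$: càglàd $f:\mathbb{T}\to\mathbb{R}$ with $\int f\,dW=0$.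 For $n\ge1$, $C^n_{W,V}(\mathbb{T})$ is the direct sum of the constants and the set of $f\in C_0(\mathbb{T})$ such that $D^{(n)}_{W,V}f$ exists everywhere and lies in $C_1(\mathbb{T})$ if $n$ is odd, in $C_0(\mathbb{T})$ if $n$ is even. $C^\infty_{W,V}(\mathbb{T})$ is the direct sum of the constants and the set of $f\in C_0(\mathbb{T})$ satisfying this for all $n\ge1$; $C^\infty_{V,W}(\mathbb{T})$ is the analogue with roles exchanged: constants plus $g\in C_1(\mathbb{T})$ whose alternating derivatives $D^+_Vg\in C_0(\mathbb{T})$, $D^-_WD^+_Vg\in C_1(\mathbb{T})$, ... all exist. Weak derivatives: $f\in L^2_V(\mathbb{T})$ has weak derivative $D^-_Wf=F\in L^2_W(\mathbb{T})$ if $\int_{\mathbb{T}}f\,D^+_Vg\,dV=-\int_{\mathbb{T}}Fg\,dW$ for all $g\in C^\infty_{V,W}(\mathbb{T})$; $h\in L^2_W(\mathbb{T})$ has weak derivative $D^+_Vh=H\in L^2_V(\mathbb{T})$ if $\int_{\mathbb{T}}h\,D^-_Wg\,dW=-\int_{\mathbb{T}}Hg\,dV$ for all $g\in C^\infty_{W,V}(\mathbb{T})$. $H^k_{W,V}(\mathbb{T})$ is the set of $f\in L^2_V(\mathbb{T})$ for which the weak $D^{(n)}_{W,V}f$ exists in $L^2_{\kappa(n)}(\mathbb{T})$ for $n=1,\dots,k$, with $\kappa(n)=W$ for $n$ odd and $V$ for $n$ even. *)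

theory Defs
  imports "HOL-Analysis.Analysis"
begin

text \<open>Functions on the circle \<open>\<real>/\<int>\<close> are represented by 1-periodic functions on \<open>\<real>\<close>.\<close>

definition periodic1 :: "(real \<Rightarrow> real) \<Rightarrow> bool" where
  "periodic1 f \<longleftrightarrow> (\<forall>x. f (x + 1) = f x)"

definition cadlag :: "(real \<Rightarrow> real) \<Rightarrow> bool" where
  "cadlag f \<longleftrightarrow> (\<forall>x. continuous (at_right x) f \<and> (\<exists>l. (f \<longlongrightarrow> l) (at_left x)))"

definition caglad :: "(real \<Rightarrow> real) \<Rightarrow> bool" where
  "caglad f \<longleftrightarrow> (\<forall>x. continuous (at_left x) f \<and> (\<exists>l. (f \<longlongrightarrow> l) (at_right x)))"

definition discont :: "(real \<Rightarrow> real) \<Rightarrow> real set" where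
  "discont f = {x. \<not> isCont f x}"

text \<open>For left-continuous increasing \<open>V\<close>, the measure with \<open>dV [a,b) = V b - V a\<close> is the
  reflection of the measure of the right-continuous function \<open>x \<mapsto> - V (- x)\<close>.\<close>

definition left_interval_measure :: "(real \<Rightarrow> real) \<Rightarrow> real measure" where
  "left_interval_measure V = distr (interval_measure (\<lambda>x. - V (- x))) borel uminus"

lemma emeasure_left_interval_measure_Ico:
  assumes "a \<le> b" and mono: "\<And>x y. x \<le> y \<Longrightarrow> V x \<le> V y"
    and cont: "\<And>x. continuous (at_left x) V"
  shows "emeasure (left_interval_measure V) {a..<b} = ennreal (V b - V a)"
proof -
  have "continuous (at_right x) (\<lambda>x. - V (- x))" for x
    using cont[of "- x"]
    by (auto simp: continuous_within filterlim_at_left_to_right intro!: tendsto_minus)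
  moreover have "uminus -` {a..<b} = {- b<..- a}" by auto
  ultimately show ?thesis
    unfolding left_interval_measure_def
    using assms(1) mono
    by (subst emeasure_distr) (auto simp: emeasure_interval_measure_Ioc)
qed

text \<open>The induced measures on the circle, with fundamental domain \<open>[0,1)\<close>.  As \<open>W\<close> and \<open>V\<close> are
  continuous at \<open>0\<close> and have 1-periodic increments, there are no atoms at \<open>0\<close> and \<open>1\<close>, so the
  choice of endpoint does not matter.\<close>

definition dW :: "(real \<Rightarrow> real) \<Rightarrow> real measure" where
  "dW W = restrict_space (interval_measure W) {0..<1}"

definition dV :: "(real \<Rightarrow> real) \<Rightarrow> real measure" where
  "dV V = restrict_space (left_interval_measure V) {0..<1}"

text \<open>Elements of \<open>L\<^sup>2\<close> are Borel representatives; they are not identified almost everywhere.\<close>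

definition L2 :: "real measure \<Rightarrow> (real \<Rightarrow> real) set" where
  "L2 M = {f. periodic1 f \<and> f \<in> borel_measurable borel \<and> integrable M (\<lambda>x. (f x)\<^sup>2)}"

definition strong_D_minus :: "(real \<Rightarrow> real) \<Rightarrow> (real \<Rightarrow> real) \<Rightarrow> (real \<Rightarrow> real) \<Rightarrow> bool" where
  "strong_D_minus W f F \<longleftrightarrow>
    (\<forall>x. ((\<lambda>h. (f (x + h) - f x) / (W (x + h) - W x)) \<longlongrightarrow> F x) (at_left 0))"

definition strong_D_plus :: "(real \<Rightarrow> real) \<Rightarrow> (real \<Rightarrow> real) \<Rightarrow> (real \<Rightarrow> real) \<Rightarrow> bool" where
  "strong_D_plus V g G \<longleftrightarrow>
    (\<forall>x. ((\<lambda>h. (g (x + h) - g x) / (V (x + h) - V x)) \<longlongrightarrow> G x) (at_right 0))"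

text \<open>\<open>alt_deriv A B n f F\<close>: \<open>F\<close> is the \<open>n\<close>-fold alternating derivative of \<open>f\<close>, where the
  derivative relation \<open>A\<close> is applied first, then \<open>B\<close>, then \<open>A\<close>, and so on.\<close>

fun alt_deriv :: "('a \<Rightarrow> 'a \<Rightarrow> bool) \<Rightarrow> ('a \<Rightarrow> 'a \<Rightarrow> bool) \<Rightarrow> nat \<Rightarrow> 'a \<Rightarrow> 'a \<Rightarrow> bool" where
  "alt_deriv A B 0 f F \<longleftrightarrow> F = f"
| "alt_deriv A B (Suc n) f F \<longleftrightarrow>
    (\<exists>G. alt_deriv A B n f G \<and> (if even n then A G F else B G F))"

definition C0 :: "(real \<Rightarrow> real) \<Rightarrow> (real \<Rightarrow> real) set" where
  "C0 V = {f. periodic1 f \<and> cadlag f \<and> (LINT x|dV V. f x) = 0}"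

definition C1 :: "(real \<Rightarrow> real) \<Rightarrow> (real \<Rightarrow> real) set" where
  "C1 W = {f. periodic1 f \<and> caglad f \<and> (LINT x|dW W. f x) = 0}"

definition strong_class_WV ::
  "(real \<Rightarrow> real) \<Rightarrow> (real \<Rightarrow> real) \<Rightarrow> nat \<Rightarrow> (real \<Rightarrow> real) set" where
  "strong_class_WV W V n = {f \<in> C0 V. \<exists>F. alt_deriv (strong_D_minus W) (strong_D_plus V) n f F \<and>
     F \<in> (if odd n then C1 W else C0 V)}"

definition strong_class_VW ::
  "(real \<Rightarrow> real) \<Rightarrow> (real \<Rightarrow> real) \<Rightarrow> nat \<Rightarrow> (real \<Rightarrow> real) set" where
  "strong_class_VW V W n = {g \<in> C1 W. \<exists>G. alt_deriv (strong_D_plus V) (strong_D_minus W) n g G \<and>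
     G \<in> (if odd n then C0 V else C1 W)}"

definition Cn_WV :: "(real \<Rightarrow> real) \<Rightarrow> (real \<Rightarrow> real) \<Rightarrow> nat \<Rightarrow> (real \<Rightarrow> real) set" where
  "Cn_WV W V n =
    (if n = 0 then {f. periodic1 f \<and> cadlag f \<and> discont f \<subseteq> discont W}
     else {(\<lambda>x. c + f x) | c f. f \<in> strong_class_WV W V n})"

definition Cinf_WV :: "(real \<Rightarrow> real) \<Rightarrow> (real \<Rightarrow> real) \<Rightarrow> (real \<Rightarrow> real) set" where
  "Cinf_WV W V = {(\<lambda>x. c + f x) | c f. \<forall>n\<ge>1. f \<in> strong_class_WV W V n}"

definition Cinf_VW :: "(real \<Rightarrow> real) \<Rightarrow> (real \<Rightarrow> real) \<Rightarrow> (real \<Rightarrow> real) set" where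
  "Cinf_VW V W = {(\<lambda>x. c + g x) | c g. \<forall>n\<ge>1. g \<in> strong_class_VW V W n}"

definition weak_D_minus ::
  "(real \<Rightarrow> real) \<Rightarrow> (real \<Rightarrow> real) \<Rightarrow> (real \<Rightarrow> real) \<Rightarrow> (real \<Rightarrow> real) \<Rightarrow> bool" where
  "weak_D_minus W V f F \<longleftrightarrow> f \<in> L2 (dV V) \<and> F \<in> L2 (dW W) \<and>
    (\<forall>g\<in>Cinf_VW V W. \<forall>G. strong_D_plus V g G \<longrightarrow>
      (LINT x|dV V. f x * G x) = - (LINT x|dW W. F x * g x))"

definition weak_D_plus ::
  "(real \<Rightarrow> real) \<Rightarrow> (real \<Rightarrow> real) \<Rightarrow> (real \<Rightarrow> real) \<Rightarrow> (real \<Rightarrow> real) \<Rightarrow> bool" where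
  "weak_D_plus W V h H \<longleftrightarrow> h \<in> L2 (dW W) \<and> H \<in> L2 (dV V) \<and>
    (\<forall>g\<in>Cinf_WV W V. \<forall>G. strong_D_minus W g G \<longrightarrow>
      (LINT x|dW W. h x * G x) = - (LINT x|dV V. H x * g x))"

definition Hk_WV :: "(real \<Rightarrow> real) \<Rightarrow> (real \<Rightarrow> real) \<Rightarrow> nat \<Rightarrow> (real \<Rightarrow> real) set" where
  "Hk_WV W V k = {f \<in> L2 (dV V). \<forall>n\<in>{1..k}.
     \<exists>F. alt_deriv (weak_D_minus W V) (weak_D_plus W V) n f F \<and>
       F \<in> (if odd n then L2 (dW W) else L2 (dV V))}"

end

theory Submission imports Defs begin

text \<open>The theorem rests on a one-step statement (\<open>weak_D_representation\<close>): if \<open>f\<close> has the weak derivative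
  \<open>F\<close>, then \<open>F\<close> has mean zero and \<open>f\<close> agrees almost everywhere with a constant plus the indefinite
  Stieltjes integral \<open>prim F\<close> of \<open>F\<close>.  Such an integral is regulated: against \<open>dW\<close> it is cadlag and
  continuous wherever \<open>W\<close> is, against \<open>dV\<close> it is caglad.  An element of \<open>H\<^sup>k\<close> carries a
  chain of weak derivatives.  The last one is merely square integrable, so the one before it has a regulated
  version; the version before that one is an indefinite integral of a regulated function, which by
  the fundamental theorem \<open>D_prim\<close> is strongly differentiable everywhere, and so on
  (\<open>strong_representative\<close>).  Thus one derivative is lost, and the derivatives have mean zero because
  they can be tested with the constant \<open>1\<close>.

  For the one-step statement put \<open>u = f - prim F - mean\<close>.  Integration by parts, which is
  Fubini's theorem on the circle cut at \<open>0\<close>, says that \<open>u\<close> is orthogonal to the strong derivatives of the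
  test functions constructed below.  If \<open>u\<close> is orthogonal to the mean-zero primitives of all step functions of mean zero, then a
  second integration by parts shows that the primitive \<open>U\<close> of \<open>u\<close> is orthogonal to
  the step functions themselves; concentrating them at two points forces \<open>U\<close> to be constant and
  hence \<open>u = 0\<close> almost everywhere (\<open>orthogonal_to_prim0_steps\<close>).

  What remains is to see that there are enough test functions, although these must be infinitely often
  differentiable in the alternating sense.  Instead of the eigenfunctions of \<open>D\<^sub>V D\<^sub>W\<close>, a Mittag-Leffler
  argument supplies them (\<open>smooth_approximation\<close>).  Step functions of mean zero on one side are \<open>L\<^sup>1\<close>-close to
  primitives of step functions on the other side, because the primitive of a tall bump on a short
  interval is almost a jump (\<open>steps_prim0_approx\<close>).  So a given step function \<open>s\<^sub>0\<close> starts a sequence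
  in which the primitive of \<open>s\<^sub>n\<^sub>+\<^sub>1\<close> is as close to \<open>s\<^sub>n\<close> as desired.  Integration turns \<open>L\<^sup>1\<close>-smallness into
  uniform smallness; hence the \<open>(n + 1)\<close>-fold primitives of \<open>s\<^sub>k\<^sub>+\<^sub>n\<close> converge
  uniformly as \<open>n\<close> grows, to functions \<open>\<chi>\<^sub>k\<close> with \<open>\<chi>\<^sub>k\<close> a primitive of \<open>\<chi>\<^sub>k\<^sub>+\<^sub>1\<close>.  All alternating
  derivatives of \<open>\<chi>\<^sub>0\<close> therefore exist, and \<open>\<chi>\<^sub>0\<close> is uniformly close to the primitive of \<open>s\<^sub>0\<close>.

  The roles of \<open>W\<close> and \<open>V\<close> are exchanged by reflecting the line.  To prove each fact once, everything is indexed by a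
  side \<open>b\<close>: \<open>True\<close> stands for \<open>W\<close> and \<open>False\<close> for \<open>V\<close>.\<close>

section \<open>Half-open intervals and elementary limits\<close>

text \<open>The cells on which the Stieltjes measure of side \<open>b\<close> takes the value of the increment of its integrator.\<close>

definition half_open :: "bool \<Rightarrow> real \<Rightarrow> real \<Rightarrow> real set" where
  "half_open b x y = (if b then {x<..y} else {x..<y})"

lemma half_open_borel [measurable, simp]: "half_open b x y \<in> sets borel"
  by (simp add: half_open_def)

lemma half_open_split:
  assumes "x \<le> y" "y \<le> z"
  shows "half_open b x z = half_open b x y \<union> half_open b y z"
    and "half_open b x y \<inter> half_open b y z = {}"
  using assms by (auto simp: half_open_def)

lemma half_open_bounds: "z \<in> half_open b x y \<Longrightarrow> x \<le> z \<and> z \<le> y"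
  by (auto simp: half_open_def split: if_splits)

lemma half_open_mono: "x' \<le> x \<Longrightarrow> y \<le> y' \<Longrightarrow> half_open b x y \<subseteq> half_open b x' y'"
  by (auto simp: half_open_def)

lemma half_open_empty [simp]: "half_open b x x = {}"
  by (simp add: half_open_def)

lemma half_open_shift: "x + c \<in> half_open b (u + c) (v + c) \<longleftrightarrow> x \<in> half_open b u v"
  by (auto simp: half_open_def)

lemma sigma_half_open: "sigma UNIV (range (\<lambda>(x, y). half_open b x y)) = borel"
proof (cases b)
  case True
  then show ?thesis
    using borel_sigma_sets_Ioc by (simp add: half_open_def)
next
  case False
  then show ?thesis using borel_eq_atLeastLessThan by (simp add: half_open_def)
qed

lemma measure_eqI_half_open:
  assumes sets: "sets N = sets borel" "sets K = sets borel"
    and eq: "\<And>x y. x \<le> y \<Longrightarrow> emeasure N (half_open b x y) = emeasure K (half_open b x y)"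
    and fin: "\<And>x y. x \<le> y \<Longrightarrow> emeasure N (half_open b x y) \<noteq> \<infinity>"
  shows "N = K"
proof (rule measure_eqI_generator_eq)
  let ?E = "range (\<lambda>(x, y). half_open b x y)"
  have sb: "sets borel = sigma_sets UNIV ?E"
    unfolding sigma_half_open[of b, symmetric] by (simp add: sets_measure_of)
  show "Int_stable ?E"
  proof (rule Int_stableI)
    fix A B assume "A \<in> ?E" "B \<in> ?E"
    then obtain x y x' y' where AB: "A = half_open b x y" "B = half_open b x' y'" by auto
    have "A \<inter> B = half_open b (max x x') (min y y')"
      unfolding AB by (auto simp: half_open_def)
    then show "A \<inter> B \<in> ?E" by auto
  qed
  show "sets N = sigma_sets UNIV ?E" "sets K = sigma_sets UNIV ?E" using sets sb by auto
  show "emeasure N X = emeasure K X" if X: "X \<in> ?E" for X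
  proof -
    obtain x y where X: "X = half_open b x y" using X by auto
    show ?thesis
    proof (cases "x \<le> y")
      case True then show ?thesis using eq X by simp
    next
      case False then have "X = {}" unfolding X by (auto simp: half_open_def)
      then show ?thesis by simp
    qed
  qed
  show "range (\<lambda>n::nat. half_open b (- real n) (real n)) \<subseteq> ?E" by auto
  show "(\<Union>n::nat. half_open b (- real n) (real n)) = UNIV"
  proof (intro equalityI subsetI UNIV_I)
    fix x :: real
    obtain n :: nat where "\<bar>x\<bar> < real n" using reals_Archimedean2 by blast
    then have "x \<in> half_open b (- real n) (real n)" by (auto simp: half_open_def)
    then show "x \<in> (\<Union>n::nat. half_open b (- real n) (real n))" by blast
  qed
  show "emeasure N (half_open b (- real n) (real n)) \<noteq> \<infinity>" for n :: nat by (rule fin) simp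
qed auto

lemma singleton_or_empty:
  "(\<And>z. z \<in> X \<Longrightarrow> z = x) \<Longrightarrow> (x \<in> X \<longleftrightarrow> P) \<Longrightarrow> X = (if P then {x} else {})"
  by auto

lemma periodic1_frac:
  assumes "periodic1 f" shows "f (frac x) = f x"
proof -
  interpret periodic_fun_simple' f
    using assms by unfold_locales (simp add: periodic1_def)
  have "f (x - of_int \<lfloor>x\<rfloor>) = f x" by (rule minus_of_int)
  then show ?thesis by (simp add: frac_def)
qed

lemma geometric_Cauchy_limit:
  fixes u :: "nat \<Rightarrow> real"
  assumes step: "\<And>n. \<bar>u n - u (Suc n)\<bar> \<le> e * (1/2) ^ Suc n"
  shows "u \<longlonglongrightarrow> lim u" and "\<bar>u n - lim u\<bar> \<le> e * (1/2) ^ n"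
proof -
  have bound: "\<bar>u n - u (n + j)\<bar> \<le> e * (1/2) ^ n - e * (1/2) ^ (n + j)" for n j
  proof (induction j)
    case (Suc j)
    have "e * (1/2) ^ (n + Suc j) = e * (1/2) ^ (n + j) / 2" by simp
    with Suc step[of "n + j"] show ?case unfolding add_Suc_right by linarith
  qed simp
  have e: "e \<ge> 0" using order_trans[OF abs_ge_zero step[of 0]] by simp
  have tail: "\<bar>u n - u m\<bar> \<le> e * (1/2) ^ n" if "n \<le> m" for n m
  proof -
    have "0 \<le> e * (1/2) ^ m" using e by simp
    then show ?thesis using bound[of n "m - n"] that by simp
  qed
  have to0: "(\<lambda>n. e * (1/2) ^ n) \<longlonglongrightarrow> 0"
    by (intro tendsto_mult_right_zero LIMSEQ_realpow_zero) auto
  have "Cauchy u"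
  proof (rule CauchyI')
    fix r :: real assume "r > 0"
    then obtain N where N: "\<And>n. n \<ge> N \<Longrightarrow> \<bar>e * (1/2) ^ n\<bar> < r"
      using to0 by (metis LIMSEQ_iff diff_zero real_norm_def)
    have "dist (u m) (u n) < r" if "N \<le> m" "m < n" for m n
      using tail[of m n] N[of m] that by (simp add: dist_real_def)
    then show "\<exists>M. \<forall>m\<ge>M. \<forall>n>m. dist (u m) (u n) < r" by blast
  qed
  then show L: "u \<longlonglongrightarrow> lim u" by (simp add: Cauchy_convergent_iff convergent_LIMSEQ_iff)
  have "(\<lambda>m. \<bar>u n - u m\<bar>) \<longlonglongrightarrow> \<bar>u n - lim u\<bar>" by (intro tendsto_intros L)
  then show "\<bar>u n - lim u\<bar> \<le> e * (1/2) ^ n"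
    by (rule LIMSEQ_le_const2) (use tail in blast)
qed

section \<open>The two Stieltjes measures\<close>

locale circle_pair =
  fixes W V :: "real \<Rightarrow> real"
  assumes W_strict: "strict_mono W" and V_strict: "strict_mono V"
    and W_cadlag: "cadlag W" and V_caglad: "caglad V"
    and W_shift: "\<And>x. W (x + 1) - W x = W 1 - W 0"
    and V_shift: "\<And>x. V (x + 1) - V x = V 1 - V 0"
    and W_cont: "isCont W 0" and V_cont: "isCont V 0"
begin

definition Phi :: "bool \<Rightarrow> real \<Rightarrow> real" where
  "Phi b = (if b then W else V)"

definition M :: "bool \<Rightarrow> real measure" where
  "M b = (if b then interval_measure W else left_interval_measure V)"

definition mu :: "bool \<Rightarrow> real measure" where
  "mu b = restrict_space (M b) {0..<1}"

lemma mu_True: "mu True = dW W" and mu_False: "mu False = dV V"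
  by (simp_all add: mu_def M_def dW_def dV_def)

lemma Phi_strict: "x < y \<Longrightarrow> Phi b x < Phi b y"
  using W_strict V_strict by (simp add: Phi_def strict_mono_def)

lemma Phi_mono: "x \<le> y \<Longrightarrow> Phi b x \<le> Phi b y"
  using Phi_strict[of x y b] by (cases "x = y") auto

lemma Phi_shift: "Phi b (x + 1) - Phi b x = Phi b 1 - Phi b 0"
  using W_shift V_shift by (simp add: Phi_def)

lemma Phi_cont: "isCont (Phi b) 0"
  using W_cont V_cont by (simp add: Phi_def)

lemma sets_M [simp, measurable_cong]: "sets (M b) = sets borel"
  by (simp add: M_def left_interval_measure_def)

lemma space_M [simp]: "space (M b) = UNIV"
  by (simp add: M_def left_interval_measure_def)

lemma emeasure_half_open:
  assumes "x \<le> y"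
  shows "emeasure (M b) (half_open b x y) = ennreal (Phi b y - Phi b x)"
proof (cases b)
  case True
  have "emeasure (interval_measure W) {x<..y} = ennreal (W y - W x)"
    using W_cadlag Phi_mono[of _ _ True]
    by (intro emeasure_interval_measure_Ioc assms) (auto simp: cadlag_def Phi_def)
  then show ?thesis using True by (simp add: M_def half_open_def Phi_def)
next
  case False
  have "emeasure (left_interval_measure V) {x..<y} = ennreal (V y - V x)"
    using V_caglad Phi_mono[of _ _ False]
    by (intro emeasure_left_interval_measure_Ico assms) (auto simp: caglad_def Phi_def)
  then show ?thesis using False by (simp add: M_def half_open_def Phi_def)
qed

lemma measure_half_open: "x \<le> y \<Longrightarrow> measure (M b) (half_open b x y) = Phi b y - Phi b x"
  by (simp add: measure_def emeasure_half_open Phi_mono)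

lemma emeasure_bounded:
  assumes "A \<in> sets borel" "A \<subseteq> {x..y}"
  shows "emeasure (M b) A < \<infinity>"
proof (cases "x \<le> y")
  case True
  have "emeasure (M b) A \<le> emeasure (M b) (half_open b (x - 1) (y + 1))"
    using assms by (intro emeasure_mono) (auto simp: half_open_def)
  also have "\<dots> < \<infinity>" using True by (subst emeasure_half_open) auto
  finally show ?thesis .
qed (use assms in auto)

lemma atom_null:
  assumes "isCont (Phi b) x"
  shows "emeasure (M b) {x} = 0"
proof -
  have "emeasure (M b) {x} \<le> ennreal e" if "e > 0" for e :: real
  proof -
    obtain d where d: "d > 0" "\<And>y. \<bar>y - x\<bar> < d \<Longrightarrow> \<bar>Phi b y - Phi b x\<bar> < e / 2"
      using assms \<open>e > 0\<close> unfolding continuous_at_eps_delta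
      by (metis dist_real_def half_gt_zero_iff)
    have "\<bar>Phi b (x + d / 2) - Phi b x\<bar> < e / 2" "\<bar>Phi b (x - d / 2) - Phi b x\<bar> < e / 2"
      using d by (auto intro!: d(2))
    then have le: "Phi b (x + d / 2) - Phi b (x - d / 2) \<le> e" by linarith
    have "emeasure (M b) {x} \<le> emeasure (M b) (half_open b (x - d/2) (x + d/2))"
      using d by (intro emeasure_mono) (auto simp: half_open_def)
    also have "\<dots> = ennreal (Phi b (x + d / 2) - Phi b (x - d / 2))"
      using d by (intro emeasure_half_open) auto
    also have "\<dots> \<le> ennreal e" using le by (rule ennreal_leI)
    finally show ?thesis .
  qed
  then have "emeasure (M b) {x} \<le> 0"
    using ennreal_le_epsilon[of 0 "emeasure (M b) {x}"] by simp
  then show ?thesis by simp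
qed

lemma Phi_cont_1: "isCont (Phi b) 1"
proof -
  have eq: "Phi b = (\<lambda>x. Phi b (x - 1) + (Phi b 1 - Phi b 0))"
    using Phi_shift[of b "x - 1" for x] by (simp add: fun_eq_iff algebra_simps)
  have "isCont (\<lambda>x. Phi b (x - 1) + (Phi b 1 - Phi b 0)) 1"
    using isCont_o2[of 1 "\<lambda>x. x - 1" "Phi b"] Phi_cont by (intro continuous_add) auto
  then show ?thesis by (subst eq)
qed

lemma AE_neq_0: "AE x in M b. x \<noteq> 0" and AE_neq_1: "AE x in M b. x \<noteq> 1"
  using AE_not_in[of "{0}" "M b"] AE_not_in[of "{1}" "M b"]
    atom_null[OF Phi_cont, of b] atom_null[OF Phi_cont_1, of b]
  by (auto simp: null_sets_def)

lemma sigma_finite_M: "sigma_finite_measure (M b)"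
proof
  show "\<exists>A. countable A \<and> A \<subseteq> sets (M b) \<and> \<Union>A = space (M b) \<and> (\<forall>a\<in>A. emeasure (M b) a \<noteq> \<infinity>)"
  proof (intro exI[of _ "range (\<lambda>n::nat. {- real n..real n})"] conjI ballI)
    show "\<Union> (range (\<lambda>n::nat. {- real n..real n})) = space (M b)"
    proof (intro equalityI subsetI)
      fix x :: real
      obtain n :: nat where "\<bar>x\<bar> < real n" using reals_Archimedean2 by blast
      then have "x \<in> {- real n..real n}" by auto
      then show "x \<in> \<Union> (range (\<lambda>n::nat. {- real n..real n}))" by blast
    qed simp
  next
    fix a assume "a \<in> range (\<lambda>n::nat. {- real n..real n})"
    then obtain n :: nat where "a = {- real n..real n}" by auto
    then show "emeasure (M b) a \<noteq> \<infinity>"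
      using emeasure_bounded[of a "- real n" "real n" b] by simp
  qed auto
qed

lemma space_mu [simp]: "space (mu b) = {0..<1}"
  by (simp add: mu_def space_restrict_space)

lemma borel_measurable_mu: "f \<in> borel_measurable borel \<Longrightarrow> f \<in> borel_measurable (mu b)"
  unfolding mu_def by (intro measurable_restrict_space1) (simp add: measurable_def)

lemma finite_measure_mu: "finite_measure (mu b)"
proof
  have "emeasure (mu b) (space (mu b)) = emeasure (M b) {0..<1}"
    by (simp add: mu_def space_restrict_space emeasure_restrict_space)
  then show "emeasure (mu b) (space (mu b)) \<noteq> \<infinity>"
    using emeasure_bounded[of "{0..<1}" 0 1 b] by (auto simp: subset_eq)
qed

lemma integral_mu:
  assumes [measurable]: "f \<in> borel_measurable borel"
  shows "(LINT x|mu b. f x) = (LINT x:half_open b 0 1|M b. (f x :: real))"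
proof -
  have "(LINT x|mu b. f x) = (LINT x:{0..<1}|M b. f x)"
    unfolding mu_def set_lebesgue_integral_def by (subst integral_restrict_space) auto
  also have "\<dots> = (LINT x:half_open b 0 1|M b. f x)"
    unfolding set_lebesgue_integral_def
  proof (rule integral_cong_AE)
    show "AE x in M b. indicat_real {0..<1} x *\<^sub>R f x = indicat_real (half_open b 0 1) x *\<^sub>R f x"
      using AE_neq_0[of b] AE_neq_1[of b]
      by eventually_elim (auto simp: half_open_def split: split_indicator)
  qed auto
  finally show ?thesis .
qed

text \<open>Periodic increments make the measures invariant under the deck transformation of the covering
  \<open>\<real> \<rightarrow> \<real>/\<int>\<close>; this is what makes integrals of periodic functions independent of the chosen unit cell.\<close>

lemma M_shift: "distr (M b) borel (\<lambda>x. x + 1) = M b"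
proof (rule measure_eqI_half_open[where b = b])
  fix x y :: real assume xy: "x \<le> y"
  have "(\<lambda>x. x + 1) -` half_open b x y = half_open b (x - 1) (y - 1)"
    by (auto simp: half_open_def)
  then have "emeasure (distr (M b) borel (\<lambda>x. x + 1)) (half_open b x y) = emeasure (M b) (half_open b (x - 1) (y - 1))"
    by (subst emeasure_distr) auto
  also have "\<dots> = ennreal (Phi b (y - 1) - Phi b (x - 1))"
    using xy by (intro emeasure_half_open) simp
  also have "Phi b (y - 1) - Phi b (x - 1) = Phi b y - Phi b x"
    using Phi_shift[of b "y - 1"] Phi_shift[of b "x - 1"] by simp
  finally have eq: "emeasure (distr (M b) borel (\<lambda>x. x + 1)) (half_open b x y) = ennreal (Phi b y - Phi b x)" .
  show "emeasure (distr (M b) borel (\<lambda>x. x + 1)) (half_open b x y) = emeasure (M b) (half_open b x y)"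
    unfolding eq emeasure_half_open[OF xy] ..
  show "emeasure (distr (M b) borel (\<lambda>x. x + 1)) (half_open b x y) \<noteq> \<infinity>"
    unfolding eq by simp
qed simp_all

definition loc_int :: "bool \<Rightarrow> (real \<Rightarrow> real) \<Rightarrow> bool" where
  "loc_int b f \<longleftrightarrow> f \<in> borel_measurable borel \<and> (\<forall>x y. set_integrable (M b) {x..y} f)"

lemma loc_int_measurable: "loc_int b f \<Longrightarrow> f \<in> borel_measurable borel"
  by (simp add: loc_int_def)

lemma loc_int_set:
  assumes "loc_int b f" "A \<in> sets borel" "A \<subseteq> {x..y}"
  shows "set_integrable (M b) A f"
  using assms set_integrable_subset[of "M b" "{x..y}" f A] by (simp add: loc_int_def)

lemma loc_int_half_open: "loc_int b f \<Longrightarrow> set_integrable (M b) (half_open b' x y) f"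
  by (rule loc_int_set[where x = x and y = y]) (auto dest: half_open_bounds)

lemma set_integral_shift:
  assumes per: "periodic1 f" and [measurable]: "f \<in> borel_measurable borel"
    and [measurable]: "A \<in> sets borel" "B \<in> sets borel" and AB: "\<And>x. x + 1 \<in> B \<longleftrightarrow> x \<in> A"
  shows "set_integrable (M b) B f \<longleftrightarrow> set_integrable (M b) A f"
    and "(LINT x:B|M b. f x) = (LINT x:A|M b. f x)"
proof -
  have eq: "(\<lambda>x. indicator B (x + 1) *\<^sub>R f (x + 1)) = (\<lambda>x. indicator A x *\<^sub>R f x)"
    using per AB by (auto simp: periodic1_def fun_eq_iff indicator_def)
  have "set_integrable (M b) B f \<longleftrightarrow> integrable (distr (M b) borel (\<lambda>x. x + 1)) (\<lambda>x. indicator B x *\<^sub>R f x)"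
    unfolding set_integrable_def M_shift ..
  also have "\<dots> \<longleftrightarrow> set_integrable (M b) A f"
    unfolding set_integrable_def eq[symmetric] by (subst integrable_distr_eq) auto
  finally show "set_integrable (M b) B f \<longleftrightarrow> set_integrable (M b) A f" .
  have "(LINT x:B|M b. f x) = integral\<^sup>L (distr (M b) borel (\<lambda>x. x + 1)) (\<lambda>x. indicator B x *\<^sub>R f x)"
    unfolding set_lebesgue_integral_def M_shift ..
  also have "\<dots> = (LINT x:A|M b. f x)"
    unfolding set_lebesgue_integral_def eq[symmetric] by (subst integral_distr) auto
  finally show "(LINT x:B|M b. f x) = (LINT x:A|M b. f x)" .
qed

definition circle_int :: "bool \<Rightarrow> (real \<Rightarrow> real) \<Rightarrow> bool" where
  "circle_int b f \<longleftrightarrow> periodic1 f \<and> f \<in> borel_measurable borel \<and> integrable (mu b) f"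

text \<open>A bounded set is covered by finitely many translates of \<open>[0,1)\<close>, and shift invariance
  carries integrability from one translate to the next.\<close>

lemma circle_int_loc_int:
  assumes f: "circle_int b f"
  shows "loc_int b f"
proof -
  have per: "periodic1 f" and fm[measurable]: "f \<in> borel_measurable borel" and int: "integrable (mu b) f"
    using f by (simp_all add: circle_int_def)
  have unit: "set_integrable (M b) {0..<1} f"
    using int unfolding mu_def by (subst set_integrable_eq) auto
  have up: "set_integrable (M b) {real n..<real n + 1} f" for n :: nat
  proof (induction n)
    case (Suc n)
    have "x + 1 \<in> {real (Suc n)..<real (Suc n) + 1} \<longleftrightarrow> x \<in> {real n..<real n + 1}" for x
      by auto
    from set_integral_shift(1)[OF per fm _ _ this] Suc show ?case by simp
  qed (use unit in simp)
  have down: "set_integrable (M b) {- real n..<- real n + 1} f" for n :: nat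
  proof (induction n)
    case (Suc n)
    have "x + 1 \<in> {- real n..<- real n + 1} \<longleftrightarrow> x \<in> {- real (Suc n)..<- real (Suc n) + 1}" for x
      by auto
    from set_integral_shift(1)[OF per fm _ _ this] Suc show ?case by simp
  qed (use unit in simp)
  have block: "set_integrable (M b) {- real n..<real n} f" for n :: nat
  proof (induction n)
    case (Suc n)
    have "{- real (Suc n)..<real (Suc n)} = {- real (Suc n)..<- real (Suc n) + 1} \<union> ({- real n..<real n} \<union> {real n..<real n + 1})"
      by auto
    moreover have "set_integrable (M b) ({- real (Suc n)..<- real (Suc n) + 1} \<union> ({- real n..<real n} \<union> {real n..<real n + 1})) f"
      by (intro set_integrable_Un Suc up down) auto
    ultimately show ?case by metis
  qed simp
  have "set_integrable (M b) {x..y} f" for x y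
  proof -
    obtain n :: nat where "max \<bar>x\<bar> \<bar>y\<bar> < real n" using reals_Archimedean2 by blast
    then have "{x..y} \<subseteq> {- real n..<real n}" by auto
    then show ?thesis using set_integrable_subset[OF block[of n]] by simp
  qed
  then show ?thesis by (simp add: loc_int_def)
qed

section \<open>Primitives\<close>

text \<open>The sign for \<open>x < 0\<close> makes increments additive across \<open>0\<close>.  The primitive has to live on the
  whole line, since strong derivatives look across the cut at \<open>0\<close>.\<close>

definition prim :: "bool \<Rightarrow> (real \<Rightarrow> real) \<Rightarrow> real \<Rightarrow> real" where
  "prim b f x = (if 0 \<le> x then LINT z:half_open b 0 x|M b. f z else - (LINT z:half_open b x 0|M b. f z))"

lemma prim_0 [simp]: "prim b f 0 = 0"
  by (simp add: prim_def set_lebesgue_integral_def)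

lemma prim_1: "f \<in> borel_measurable borel \<Longrightarrow> prim b f 1 = (LINT x|mu b. f x)"
  by (simp add: prim_def integral_mu)

lemma set_integral_half_open_split:
  assumes "loc_int b f" "x \<le> y" "y \<le> z"
  shows "(LINT t:half_open b x z|M b. f t) = (LINT t:half_open b x y|M b. f t) + (LINT t:half_open b y z|M b. f t)"
  unfolding half_open_split(1)[OF assms(2,3)]
  by (intro set_integral_Un half_open_split(2) assms loc_int_half_open)

lemma prim_diff:
  assumes f: "loc_int b f" and xy: "x \<le> y"
  shows "prim b f y - prim b f x = (LINT t:half_open b x y|M b. f t)"
proof -
  consider "0 \<le> x" | "x < 0" "0 \<le> y" | "y < 0" using xy by linarith
  then show ?thesis
  proof cases
    case 1
    with set_integral_half_open_split[OF f, of 0 x y] xy show ?thesis by (simp add: prim_def)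
  next
    case 2
    with set_integral_half_open_split[OF f, of x 0 y] show ?thesis by (simp add: prim_def)
  next
    case 3
    with set_integral_half_open_split[OF f, of x y 0] xy show ?thesis by (simp add: prim_def)
  qed
qed

lemma prim_add:
  assumes "loc_int b f" "loc_int b g" shows "prim b (\<lambda>x. f x + g x) x = prim b f x + prim b g x"
  using loc_int_half_open[OF assms(1)] loc_int_half_open[OF assms(2)] by (simp add: prim_def)

lemma prim_cmult: "prim b (\<lambda>x. c * f x) x = c * prim b f x"
  by (simp add: prim_def)

lemma prim_const: "prim b (\<lambda>x. c) x = c * (Phi b x - Phi b 0)"
proof (cases "0 \<le> x")
  case True
  then show ?thesis
    using emeasure_half_open[OF True, of b] measure_half_open[OF True, of b]
    by (simp add: prim_def set_lebesgue_integral_def)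
next
  case False
  then have x: "x \<le> 0" by simp
  show ?thesis
    using False emeasure_half_open[OF x, of b] measure_half_open[OF x, of b]
    by (simp add: prim_def set_lebesgue_integral_def, simp add: algebra_simps)
qed

lemma loc_int_add: "loc_int b f \<Longrightarrow> loc_int b g \<Longrightarrow> loc_int b (\<lambda>x. f x + g x)"
  by (auto simp: loc_int_def)

lemma loc_int_cmult: "loc_int b f \<Longrightarrow> loc_int b (\<lambda>x. c * f x)"
  unfolding loc_int_def by (intro conjI borel_measurable_times) auto

text \<open>The increment over a period is the integral over the circle, which is the only obstruction to periodicity.\<close>

lemma prim_periodic:
  assumes f: "circle_int b f" and mean: "(LINT x|mu b. f x) = 0"
  shows "periodic1 (prim b f)"
proof -
  have per: "periodic1 f" and [measurable]: "f \<in> borel_measurable borel"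
    using f by (simp_all add: circle_int_def)
  note l = circle_int_loc_int[OF f]
  have sh: "(LINT t:half_open b (x + 1) (y + 1)|M b. f t) = (LINT t:half_open b x y|M b. f t)" for x y
    by (intro set_integral_shift per) (auto simp: half_open_shift)
  have "prim b f (x + 1) - prim b f 1 = prim b f x - prim b f 0" for x
  proof (cases "0 \<le> x")
    case True
    have "prim b f x - prim b f 0 = (LINT t:half_open b 0 x|M b. f t)"
      using True by (rule prim_diff[OF l])
    moreover have "prim b f (x + 1) - prim b f 1 = (LINT t:half_open b 1 (x + 1)|M b. f t)"
      using True by (intro prim_diff[OF l]) simp
    ultimately show ?thesis using sh[of 0 x] by simp
  next
    case False
    have "prim b f 0 - prim b f x = (LINT t:half_open b x 0|M b. f t)"
      using False by (intro prim_diff[OF l]) simp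
    moreover have "prim b f 1 - prim b f (x + 1) = (LINT t:half_open b (x + 1) 1|M b. f t)"
      using False by (intro prim_diff[OF l]) simp
    ultimately show ?thesis using sh[of x 0] by simp
  qed
  then show ?thesis using prim_1[of f b] mean by (simp add: periodic1_def)
qed

lemma prim_mono:
  assumes "loc_int b f" "\<And>x. 0 \<le> f x"
  shows "mono (prim b f)"
proof (rule monoI)
  fix x y :: real assume "x \<le> y"
  have "0 \<le> (LINT t:half_open b x y|M b. f t)"
    unfolding set_lebesgue_integral_def using assms(2) by (intro integral_nonneg_AE) auto
  then show "prim b f x \<le> prim b f y" using prim_diff[OF assms(1) \<open>x \<le> y\<close>] by simp
qed

text \<open>Primitives of nonnegative functions are monotone, so a general primitive is a difference of monotone functions.\<close>

lemma prim_measurable: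
  assumes f: "loc_int b f"
  shows "prim b f \<in> borel_measurable borel"
proof -
  have abs: "loc_int b (\<lambda>x. \<bar>f x\<bar>)"
    using f by (auto simp: loc_int_def intro: set_integrable_abs)
  have "loc_int b (\<lambda>x. \<bar>f x\<bar> + f x)" by (intro loc_int_add f abs)
  then have "mono (prim b (\<lambda>x. \<bar>f x\<bar> + f x))" by (rule prim_mono) simp
  moreover have "mono (prim b (\<lambda>x. \<bar>f x\<bar>))" by (rule prim_mono[OF abs]) simp
  moreover have "prim b f = (\<lambda>x. prim b (\<lambda>x. \<bar>f x\<bar> + f x) x - prim b (\<lambda>x. \<bar>f x\<bar>) x)"
    by (simp add: prim_add[OF abs f])
  ultimately show ?thesis
    using borel_measurable_diff[OF borel_measurable_mono borel_measurable_mono] by metis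
qed

text \<open>Since \<open>half_open b x y\<close> shrinks to \<open>{}\<close> or to \<open>{x}\<close> according to the side as \<open>y\<close> decreases to \<open>x\<close>,
  an atom at \<open>x\<close> is felt from the right only on the \<open>V\<close>-side.\<close>

lemma prim_at_right:
  assumes f: "loc_int b f"
  shows "(prim b f \<longlongrightarrow> prim b f x + (if b then 0 else LINT t:{x}|M b. f t)) (at_right x)"
proof (rule tendsto_at_right_sequentially[of x "x + 1"])
  fix S :: "nat \<Rightarrow> real"
  assume S: "\<And>n. x < S n" "decseq S" "S \<longlonglongrightarrow> x"
  define A where "A n = half_open b x (S n)" for n
  have dec: "decseq A"
    using S(2) unfolding A_def decseq_def by (intro allI impI half_open_mono) auto
  have "(\<lambda>n. LINT t:A n|M b. f t) \<longlonglongrightarrow> (LINT t:(\<Inter>n. A n)|M b. f t)"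
    using dec loc_int_half_open[OF f] by (intro set_integral_cont_down) (auto simp: A_def[abs_def])
  also have "(\<Inter>n. A n) = (if \<not> b then {x} else {})"
  proof -
    have "\<And>z. z \<in> (\<Inter>n. A n) \<Longrightarrow> z = x"
    proof -
      fix z assume "z \<in> (\<Inter>n. A n)"
      then have "x \<le> z" "z \<le> S n" for n by (auto simp: A_def dest!: spec[of _ n] half_open_bounds)
      then show "z = x" using LIMSEQ_le_const[OF S(3), of z] by force
    qed
    moreover have "x \<in> (\<Inter>n. A n) \<longleftrightarrow> \<not> b"
      using S(1) by (auto simp: A_def half_open_def)
    ultimately show ?thesis by (rule singleton_or_empty)
  qed
  also have "(LINT t:(if \<not> b then {x} else {})|M b. f t) = (if b then 0 else LINT t:{x}|M b. f t)"
    by (simp add: set_lebesgue_integral_def)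
  finally have "(\<lambda>n. prim b f x + (LINT t:A n|M b. f t)) \<longlonglongrightarrow> prim b f x + (if b then 0 else LINT t:{x}|M b. f t)"
    by (intro tendsto_intros)
  moreover have "prim b f x + (LINT t:A n|M b. f t) = prim b f (S n)" for n
    using prim_diff[OF f, of x "S n"] S(1)[of n] by (simp add: A_def)
  ultimately show "(\<lambda>n. prim b f (S n)) \<longlonglongrightarrow> prim b f x + (if b then 0 else LINT t:{x}|M b. f t)"
    by simp
qed simp

lemma prim_at_left:
  assumes f: "loc_int b f"
  shows "(prim b f \<longlongrightarrow> prim b f x - (if b then LINT t:{x}|M b. f t else 0)) (at_left x)"
proof (rule tendsto_at_left_sequentially[of "x - 1"])
  fix S :: "nat \<Rightarrow> real"
  assume S: "\<And>n. S n < x" "incseq S" "S \<longlonglongrightarrow> x"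
  define A where "A n = half_open b (S n) x" for n
  have dec: "decseq A"
    using S(2) unfolding A_def decseq_def incseq_def by (intro allI impI half_open_mono) auto
  have "(\<lambda>n. LINT t:A n|M b. f t) \<longlonglongrightarrow> (LINT t:(\<Inter>n. A n)|M b. f t)"
    using dec loc_int_half_open[OF f] by (intro set_integral_cont_down) (auto simp: A_def[abs_def])
  also have "(\<Inter>n. A n) = (if b then {x} else {})"
  proof -
    have "\<And>z. z \<in> (\<Inter>n. A n) \<Longrightarrow> z = x"
    proof -
      fix z assume "z \<in> (\<Inter>n. A n)"
      then have "S n \<le> z" "z \<le> x" for n by (auto simp: A_def dest!: spec[of _ n] half_open_bounds)
      then show "z = x" using LIMSEQ_le_const2[OF S(3), of z] by force
    qed
    moreover have "x \<in> (\<Inter>n. A n) \<longleftrightarrow> b"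
      using S(1) by (auto simp: A_def half_open_def)
    ultimately show ?thesis by (rule singleton_or_empty)
  qed
  also have "(LINT t:(if b then {x} else {})|M b. f t) = (if b then LINT t:{x}|M b. f t else 0)"
    by (simp add: set_lebesgue_integral_def)
  finally have "(\<lambda>n. prim b f x - (LINT t:A n|M b. f t)) \<longlonglongrightarrow> prim b f x - (if b then LINT t:{x}|M b. f t else 0)"
    by (intro tendsto_intros)
  moreover have "prim b f x - (LINT t:A n|M b. f t) = prim b f (S n)" for n
    using prim_diff[OF f, of "S n" x] S(1)[of n] by (simp add: A_def)
  ultimately show "(\<lambda>n. prim b f (S n)) \<longlonglongrightarrow> prim b f x - (if b then LINT t:{x}|M b. f t else 0)"
    by simp
qed simp

text \<open>The regularity of functions integrated against side \<open>b\<close>, which is that of the integrator of the other side;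
  primitives exchange the two kinds.\<close>

definition regulated :: "bool \<Rightarrow> (real \<Rightarrow> real) \<Rightarrow> bool" where
  "regulated b f = (if b then caglad f else cadlag f)"

lemma prim_regulated:
  assumes "loc_int b f"
  shows "regulated (\<not> b) (prim b f)"
  using prim_at_left[OF assms] prim_at_right[OF assms]
  by (cases b) (auto simp: regulated_def cadlag_def caglad_def continuous_within)

text \<open>A jump of a primitive at \<open>x\<close> is the value of the integrand times the atom of the measure at \<open>x\<close>.\<close>

lemma prim_isCont:
  assumes f: "loc_int b f" and x: "isCont (Phi b) x"
  shows "isCont (prim b f) x"
proof -
  have "set_integrable (M b) {x} f" by (rule loc_int_set[OF f, of _ x x]) auto
  then have "(LINT t:{x}|M b. f t) = 0"
    using atom_null[OF x] by (subst set_integral_at_point) (auto simp: measure_def)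
  then have "continuous (at_left x) (prim b f)" "continuous (at_right x) (prim b f)"
    using prim_at_left[OF f, of x] prim_at_right[OF f, of x]
    by (auto simp: continuous_within split: if_splits)
  then show ?thesis by (simp add: continuous_at_split)
qed

lemma const_loc_int: "loc_int b (\<lambda>x. c)"
  using emeasure_bounded[of "{x..y}" x y b for x y] unfolding loc_int_def set_integrable_def
  by (auto intro!: integrable_real_indicator integrable_mult_left simp: less_top)

lemma prim_increment_estimate:
  assumes f: "loc_int b f" and xy: "x \<le> y" and k: "\<And>z. z \<in> half_open b x y \<Longrightarrow> \<bar>f z - k\<bar> \<le> e"
  shows "\<bar>prim b f y - prim b f x - k * (Phi b y - Phi b x)\<bar> \<le> e * (Phi b y - Phi b x)"
proof -
  let ?A = "half_open b x y"
  have A: "(LINT t:?A|M b. c) = c * (Phi b y - Phi b x)" for c :: real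
    using prim_diff[OF const_loc_int[of b c] xy] by (simp add: prim_const algebra_simps)
  have int: "set_integrable (M b) ?A f" "\<And>c. set_integrable (M b) ?A (\<lambda>t. c :: real)"
    by (intro loc_int_half_open f const_loc_int)+
  have "prim b f y - prim b f x - k * (Phi b y - Phi b x) = (LINT t:?A|M b. f t - k)"
    using int by (simp add: prim_diff[OF f xy] A set_integral_diff)
  also have "\<bar>\<dots>\<bar> \<le> (LINT t:?A|M b. \<bar>f t - k\<bar>)"
    using set_integral_norm_bound[of "M b" ?A "\<lambda>t. f t - k"] int by simp
  also have "\<dots> \<le> (LINT t:?A|M b. e)"
    using int k by (intro set_integral_mono set_integrable_abs) auto
  finally show ?thesis by (simp add: A)
qed

definition D :: "bool \<Rightarrow> (real \<Rightarrow> real) \<Rightarrow> (real \<Rightarrow> real) \<Rightarrow> bool" where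
  "D b = (if b then strong_D_minus W else strong_D_plus V)"

lemma quotient_estimate:
  assumes "\<bar>u - k * v\<bar> \<le> e * v" "v > (0::real)" shows "\<bar>u / v - k\<bar> \<le> e"
proof -
  have "u / v - k = (u - k * v) / v" using assms(2) by (simp add: field_simps)
  also have "\<bar>\<dots>\<bar> \<le> e" using assms by (simp add: abs_divide divide_le_eq)
  finally show ?thesis .
qed

text \<open>The fundamental theorem of calculus.  At every point the difference quotient averages \<open>f\<close> over a half-open
  cell that contains the base point and lies on the side from which \<open>f\<close> is continuous, so it converges even at
  atoms.\<close>

theorem D_prim:
  assumes f: "loc_int b f" and regulated: "regulated b f"
  shows "D b (prim b f) f"
proof (cases b)
  case True
  have "((\<lambda>h. (prim b f (x + h) - prim b f x) / (W (x + h) - W x)) \<longlongrightarrow> f x) (at_left 0)" for x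
  proof (rule tendstoI)
    fix e :: real assume e: "e > 0"
    have "(f \<longlongrightarrow> f x) (at_left x)" using regulated True by (simp add: regulated_def caglad_def continuous_within)
    then have "\<forall>\<^sub>F y in at_left x. \<bar>f y - f x\<bar> < e / 2"
      using e by (auto simp: tendsto_iff dist_real_def dest: spec[of _ "e / 2"])
    then obtain c where c: "c < x" "\<And>y. c < y \<Longrightarrow> y < x \<Longrightarrow> \<bar>f y - f x\<bar> < e / 2"
      by (auto simp: eventually_at_left_field)
    have "\<forall>\<^sub>F h in at_left 0. h \<in> {c - x<..<0}"
      using c(1) by (intro eventually_at_left_real) simp
    then show "\<forall>\<^sub>F h in at_left 0. dist ((prim b f (x + h) - prim b f x) / (W (x + h) - W x)) (f x) < e"
    proof eventually_elim
      case (elim h)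
      have k: "\<bar>f z - f x\<bar> \<le> e / 2" if "z \<in> half_open b (x + h) x" for z
        using that c(2)[of z] elim True e by (cases "z = x") (auto simp: half_open_def)
      have "\<bar>prim b f x - prim b f (x + h) - f x * (W x - W (x + h))\<bar> \<le> e / 2 * (W x - W (x + h))"
        using prim_increment_estimate[OF f _ k] elim True by (simp add: Phi_def)
      moreover have "W x - W (x + h) > 0" using Phi_strict[of "x + h" x True] elim by (simp add: Phi_def)
      ultimately have "\<bar>(prim b f x - prim b f (x + h)) / (W x - W (x + h)) - f x\<bar> \<le> e / 2"
        by (rule quotient_estimate)
      moreover have "(prim b f x - prim b f (x + h)) / (W x - W (x + h)) = (prim b f (x + h) - prim b f x) / (W (x + h) - W x)"
        by (metis minus_diff_eq minus_divide_divide)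
      ultimately show ?case using e by (simp add: dist_real_def)
    qed
  qed
  then show ?thesis using True by (simp add: D_def strong_D_minus_def)
next
  case False
  have "((\<lambda>h. (prim b f (x + h) - prim b f x) / (V (x + h) - V x)) \<longlongrightarrow> f x) (at_right 0)" for x
  proof (rule tendstoI)
    fix e :: real assume e: "e > 0"
    have "(f \<longlongrightarrow> f x) (at_right x)" using regulated False by (simp add: regulated_def cadlag_def continuous_within)
    then have "\<forall>\<^sub>F y in at_right x. \<bar>f y - f x\<bar> < e / 2"
      using e by (auto simp: tendsto_iff dist_real_def dest: spec[of _ "e / 2"])
    then obtain c where c: "c > x" "\<And>y. x < y \<Longrightarrow> y < c \<Longrightarrow> \<bar>f y - f x\<bar> < e / 2"
      by (auto simp: eventually_at_right_field)
    have "\<forall>\<^sub>F h in at_right 0. h \<in> {0<..<c - x}"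
      using c(1) by (intro eventually_at_right_real) simp
    then show "\<forall>\<^sub>F h in at_right 0. dist ((prim b f (x + h) - prim b f x) / (V (x + h) - V x)) (f x) < e"
    proof eventually_elim
      case (elim h)
      have k: "\<bar>f z - f x\<bar> \<le> e / 2" if "z \<in> half_open b x (x + h)" for z
        using that c(2)[of z] elim False e by (cases "z = x") (auto simp: half_open_def)
      have "\<bar>prim b f (x + h) - prim b f x - f x * (V (x + h) - V x)\<bar> \<le> e / 2 * (V (x + h) - V x)"
        using prim_increment_estimate[OF f _ k] elim False by (simp add: Phi_def)
      moreover have "V (x + h) - V x > 0" using Phi_strict[of x "x + h" False] elim by (simp add: Phi_def)
      ultimately have "\<bar>(prim b f (x + h) - prim b f x) / (V (x + h) - V x) - f x\<bar> \<le> e / 2"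
        by (rule quotient_estimate)
      then show ?case using e by (simp add: dist_real_def)
    qed
  qed
  then show ?thesis using False by (simp add: D_def strong_D_plus_def)
qed

section \<open>Integration by parts\<close>

lemma prim_mu:
  assumes [measurable]: "f \<in> borel_measurable borel" and x: "0 \<le> x" "x < 1"
  shows "prim b f x = (LINT y|mu b. indicator (half_open b 0 x) y * f y)"
proof -
  have eq: "(\<lambda>y. indicator {0..<1} y *\<^sub>R (indicator (half_open b 0 x) y * f y)) = (\<lambda>y. indicator (half_open b 0 x) y *\<^sub>R f y)"
    using x by (auto simp: half_open_def indicator_def fun_eq_iff)
  have "(LINT y|mu b. indicator (half_open b 0 x) y * f y) = (LINT y|M b. indicator {0..<1} y *\<^sub>R (indicator (half_open b 0 x) y * f y))"
    unfolding mu_def by (intro integral_restrict_space) simp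
  then show ?thesis unfolding eq using x by (simp add: prim_def set_lebesgue_integral_def)
qed

lemma mult_indicator_integrable:
  assumes "integrable (mu b) f" shows "integrable (mu b) (\<lambda>y. indicator (half_open b' u v) y * f y :: real)"
proof -
  have [measurable]: "indicator (half_open b' u v) \<in> borel_measurable (mu b)"
    by (intro borel_measurable_mu borel_measurable_indicator) simp
  show ?thesis using assms by (rule Bochner_Integration.integrable_bound)  (use assms in \<open>auto split: split_indicator\<close>)
qed

lemma prim_bound:
  assumes f: "circle_int b f" and x: "0 \<le> x" "x < 1"
  shows "\<bar>prim b f x\<bar> \<le> (LINT y|mu b. \<bar>f y\<bar>)"
proof -
  have int: "integrable (mu b) f" and [measurable]: "f \<in> borel_measurable borel" using f by (simp_all add: circle_int_def)
  have "\<bar>prim b f x\<bar> \<le> (LINT y|mu b. \<bar>indicator (half_open b 0 x) y * f y\<bar>)"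
    using x by (simp add: prim_mu integral_abs_bound)
  also have "\<dots> \<le> (LINT y|mu b. \<bar>f y\<bar>)"
    using int mult_indicator_integrable[OF int] by (intro integral_mono) (auto split: split_indicator)
  finally show ?thesis .
qed

text \<open>Up to the null set where a coordinate is \<open>0\<close>, the square \<open>[0,1)\<times>[0,1)\<close> is the disjoint union of
  \<open>{(x, y). y \<in> half_open b 0 x}\<close> and \<open>{(x, y). x \<in> half_open (\<not> b) 0 y}\<close>: exactly one of the two cells
  contains the diagonal, so common atoms of \<open>dW\<close> and \<open>dV\<close> are counted once.  Integrating \<open>g x * f y\<close> over the two
  parts gives the two terms.\<close>

theorem integration_by_parts:
  assumes f: "circle_int b f" and g: "circle_int (\<not> b) g"
  shows "(LINT x|mu (\<not> b). prim b f x * g x) + (LINT y|mu b. prim (\<not> b) g y * f y) =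
    (LINT y|mu b. f y) * (LINT x|mu (\<not> b). g x)"
proof -
  have fi: "integrable (mu b) f" and fm[measurable]: "f \<in> borel_measurable borel" using f by (simp_all add: circle_int_def)
  have gi: "integrable (mu (\<not> b)) g" and gm[measurable]: "g \<in> borel_measurable borel" using g by (simp_all add: circle_int_def)
  interpret F: finite_measure "mu b" by (rule finite_measure_mu)
  interpret G: finite_measure "mu (\<not> b)" by (rule finite_measure_mu)
  interpret P: pair_sigma_finite "mu (\<not> b)" "mu b" ..
  have [measurable]: "f \<in> borel_measurable (mu b)" "g \<in> borel_measurable (mu (\<not> b))"
     "(\<lambda>x. x) \<in> borel_measurable (mu c)" for c
    by (auto intro: borel_measurable_mu)
  let ?I = "\<lambda>x y. indicator (half_open b 0 x) y :: real"
  have I[measurable]: "(\<lambda>(x, y). ?I x y) \<in> borel_measurable (mu (\<not> b) \<Otimes>\<^sub>M mu b)"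
  proof -
    have "(\<lambda>(x, y). if b then (if 0 < y \<and> y \<le> x then 1 else 0) else (if 0 \<le> y \<and> y < x then 1 else 0 :: real)) \<in> borel_measurable (mu (\<not> b) \<Otimes>\<^sub>M mu b)"
      by (cases b) (simp_all, measurable)
    also have "(\<lambda>(x, y). if b then (if 0 < y \<and> y \<le> x then 1 else 0) else (if 0 \<le> y \<and> y < x then 1 else 0 :: real)) = (\<lambda>(x, y). ?I x y)"
      by (auto simp: half_open_def indicator_def fun_eq_iff)
    finally show ?thesis .
  qed
  have prod: "integrable (mu (\<not> b) \<Otimes>\<^sub>M mu b) (\<lambda>(x, y). g x * f y)"
  proof (rule P.Fubini_integrable)
    show "integrable (mu (\<not> b)) (\<lambda>x. LINT y|mu b. norm (case (x, y) of (x, y) \<Rightarrow> g x * f y))"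
      using gi by (simp add: abs_mult)
    show "AE x in mu (\<not> b). integrable (mu b) (\<lambda>y. case (x, y) of (x, y) \<Rightarrow> g x * f y)"
      using fi by simp
  qed measurable
  have K: "integrable (mu (\<not> b) \<Otimes>\<^sub>M mu b) (\<lambda>(x, y). ?I x y * (g x * f y))"
    using prod by (rule Bochner_Integration.integrable_bound) (measurable, auto split: split_indicator)
  have 1: "(LINT x|mu (\<not> b). prim b f x * g x) = (LINT x|mu (\<not> b). LINT y|mu b. ?I x y * (g x * f y))"
  proof (intro Bochner_Integration.integral_cong refl)
    fix x assume "x \<in> space (mu (\<not> b))"
    then have "prim b f x = (LINT y|mu b. ?I x y * f y)" by (intro prim_mu) auto
    then have "prim b f x * g x = (LINT y|mu b. ?I x y * f y * g x)" by simp
    then show "prim b f x * g x = (LINT y|mu b. ?I x y * (g x * f y))" by (simp only: mult_ac)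
  qed
  have AE0: "AE x in mu c. x \<noteq> 0" for c
    using AE_neq_0[of c] unfolding mu_def by (subst AE_restrict_space_iff) (auto elim: eventually_mono)
  have 2: "(LINT y|mu b. prim (\<not> b) g y * f y) = (LINT y|mu b. (LINT x|mu (\<not> b). g x) * f y - (LINT x|mu (\<not> b). ?I x y * (g x * f y)))"
  proof (rule integral_cong_AE)
    show "(\<lambda>y. prim (\<not> b) g y * f y) \<in> borel_measurable (mu b)"
      using prim_measurable[OF circle_int_loc_int[OF g]] by (intro borel_measurable_mu) simp
    show "(\<lambda>y. (LINT x|mu (\<not> b). g x) * f y - (LINT x|mu (\<not> b). ?I x y * (g x * f y))) \<in> borel_measurable (mu b)"
      using P.integrable_snd[OF K] by auto
    show "AE y in mu b. prim (\<not> b) g y * f y = (LINT x|mu (\<not> b). g x) * f y - (LINT x|mu (\<not> b). ?I x y * (g x * f y))"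
      using AE0[of b] AE_space P.AE_integrable_snd[OF K]
    proof eventually_elim
      case (elim y)
      then have y: "0 < y" "y < 1" by auto
      have "prim (\<not> b) g y * f y = (LINT x|mu (\<not> b). indicator (half_open (\<not> b) 0 y) x * g x) * f y"
        using y by (subst prim_mu) auto
      also have "\<dots> = (LINT x|mu (\<not> b). indicator (half_open (\<not> b) 0 y) x * g x * f y)"
        by simp
      also have "\<dots> = (LINT x|mu (\<not> b). g x * f y - ?I x y * (g x * f y))"
      proof (rule integral_cong_AE)
        show "AE x in mu (\<not> b). indicator (half_open (\<not> b) 0 y) x * g x * f y = g x * f y - ?I x y * (g x * f y)"
          using AE0[of "\<not> b"] AE_space
          by eventually_elim (use y in \<open>auto simp: half_open_def indicator_def\<close>)
        show "(\<lambda>x. indicator (half_open (\<not> b) 0 y) x * g x * f y) \<in> borel_measurable (mu (\<not> b))"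
          by (intro borel_measurable_mu) simp
        show "(\<lambda>x. g x * f y - ?I x y * (g x * f y)) \<in> borel_measurable (mu (\<not> b))"
          using elim gi by simp
      qed
      also have "\<dots> = (LINT x|mu (\<not> b). g x) * f y - (LINT x|mu (\<not> b). ?I x y * (g x * f y))"
        using elim gi by (subst Bochner_Integration.integral_diff) auto
      finally show ?case .
    qed
  qed
  also have "\<dots> = (LINT x|mu (\<not> b). g x) * (LINT y|mu b. f y) - (LINT y|mu b. LINT x|mu (\<not> b). ?I x y * (g x * f y))"
    using fi P.integrable_snd[OF K] by (subst Bochner_Integration.integral_diff) auto
  also have "(LINT y|mu b. LINT x|mu (\<not> b). ?I x y * (g x * f y)) = (LINT x|mu (\<not> b). LINT y|mu b. ?I x y * (g x * f y))"
    by (rule P.Fubini_integral[OF K])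
  finally show ?thesis using 1 by simp
qed

section \<open>Primitives of mean zero\<close>

lemma Phi_01: "Phi b 1 - Phi b 0 > 0"
  using Phi_strict[of 0 1 b] by simp

lemma measure_mu [simp]: "measure (mu b) {0..<1} = Phi b 1 - Phi b 0"
  using prim_1[of "\<lambda>x. 1" b] prim_const[of b 1 1] by simp

lemma integral_mu_const: "(LINT x|mu b. c) = c * (Phi b 1 - Phi b 0)"
  by simp

definition mean :: "bool \<Rightarrow> (real \<Rightarrow> real) \<Rightarrow> real" where
  "mean b f = (LINT x|mu b. f x) / (Phi b 1 - Phi b 0)"

text \<open>The mean is taken on the opposite side, where the primitive is integrated next; this makes \<open>prim0\<close> iterable.\<close>

definition prim0 :: "bool \<Rightarrow> (real \<Rightarrow> real) \<Rightarrow> real \<Rightarrow> real" where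
  "prim0 b f x = prim b f x - mean (\<not> b) (prim b f)"

definition bounded_mean_zero :: "bool \<Rightarrow> (real \<Rightarrow> real) set" where
  "bounded_mean_zero b = {f. periodic1 f \<and> f \<in> borel_measurable borel \<and> (\<exists>K. \<forall>x. \<bar>f x\<bar> \<le> K) \<and> (LINT x|mu b. f x) = 0}"

lemma bounded_circle_int:
  assumes "periodic1 f" "f \<in> borel_measurable borel" "\<And>x. \<bar>f x\<bar> \<le> K"
  shows "circle_int b f"
proof -
  interpret finite_measure "mu b" by (rule finite_measure_mu)
  have "integrable (mu b) f"
    using assms by (intro integrable_const_bound[where B = K] borel_measurable_mu) auto
  then show ?thesis using assms by (simp add: circle_int_def)
qed

lemma bounded_mean_zero_circle_int: "f \<in> bounded_mean_zero b \<Longrightarrow> circle_int b' f"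
  unfolding bounded_mean_zero_def using bounded_circle_int by blast

lemma circle_int_integrable: "circle_int b f \<Longrightarrow> integrable (mu b) f"
  by (simp add: circle_int_def)

lemma prim_circle_int:
  assumes f: "circle_int b f" and mean: "(LINT x|mu b. f x) = 0"
  shows "circle_int b' (prim b f)"
proof (rule bounded_circle_int)
  show per: "periodic1 (prim b f)" by (rule prim_periodic[OF assms])
  show "prim b f \<in> borel_measurable borel" by (rule prim_measurable[OF circle_int_loc_int[OF f]])
  show "\<bar>prim b f x\<bar> \<le> (LINT y|mu b. \<bar>f y\<bar>)" for x
    using prim_bound[OF f, of "frac x"] periodic1_frac[OF per, of x] by (simp add: frac_ge_0 frac_lt_1)
qed

lemma integral_minus_mean:
  assumes "integrable (mu b) f" shows "(LINT x|mu b. f x - mean b f) = 0"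
proof -
  interpret finite_measure "mu b" by (rule finite_measure_mu)
  show ?thesis using assms Phi_01[of b] by (simp add: integral_mu_const mean_def)
qed

lemma integral_bound_const:
  assumes f: "integrable (mu b) f" and "\<And>x. 0 \<le> x \<Longrightarrow> x < 1 \<Longrightarrow> \<bar>f x\<bar> \<le> K"
  shows "(LINT x|mu b. \<bar>f x\<bar>) \<le> K * (Phi b 1 - Phi b 0)"
proof -
  interpret finite_measure "mu b" by (rule finite_measure_mu)
  have "(LINT x|mu b. \<bar>f x\<bar>) \<le> (LINT x|mu b. K)"
    using assms by (intro integral_mono) auto
  then show ?thesis by (simp add: mult.commute)
qed

lemma abs_mean_le:
  assumes f: "integrable (mu b) f" and "\<And>x. 0 \<le> x \<Longrightarrow> x < 1 \<Longrightarrow> \<bar>f x\<bar> \<le> K"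
  shows "\<bar>mean b f\<bar> \<le> K"
proof -
  have "\<bar>LINT x|mu b. f x\<bar> \<le> K * (Phi b 1 - Phi b 0)"
    using integral_bound_const[OF assms] integral_abs_bound[of "mu b" f] by linarith
  then show ?thesis using Phi_01[of b] by (simp add: mean_def abs_divide divide_le_eq)
qed

text \<open>Integration maps \<open>L\<^sup>1\<close> boundedly into the bounded functions.  This gain drives the Mittag-Leffler argument below.\<close>

lemma prim0_bound:
  assumes f: "circle_int b f" and mean: "(LINT x|mu b. f x) = 0"
  shows "\<bar>prim0 b f x\<bar> \<le> 2 * (LINT y|mu b. \<bar>f y\<bar>)"
proof -
  note per = prim_periodic[OF assms]
  have "\<bar>prim b f x\<bar> \<le> (LINT y|mu b. \<bar>f y\<bar>)"
    using prim_bound[OF f, of "frac x"] periodic1_frac[OF per, of x] by (simp add: frac_ge_0 frac_lt_1)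
  moreover have "\<bar>mean (\<not> b) (prim b f)\<bar> \<le> (LINT y|mu b. \<bar>f y\<bar>)"
    using circle_int_integrable[OF prim_circle_int[OF assms]] prim_bound[OF f] by (rule abs_mean_le)
  ultimately show ?thesis unfolding prim0_def by linarith
qed

lemma prim0_bounded_mean_zero:
  assumes f: "circle_int b f" and mean: "(LINT x|mu b. f x) = 0"
  shows "prim0 b f \<in> bounded_mean_zero (\<not> b)"
  unfolding bounded_mean_zero_def mem_Collect_eq
proof (intro conjI)
  show "periodic1 (prim0 b f)"
    using prim_periodic[OF assms] by (simp add: periodic1_def prim0_def)
  show "prim0 b f \<in> borel_measurable borel"
    using prim_measurable[OF circle_int_loc_int[OF f]] unfolding prim0_def[abs_def] by simp
  show "\<exists>K. \<forall>x. \<bar>prim0 b f x\<bar> \<le> K"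
    using prim0_bound[OF assms] by blast
  show "(LINT x|mu (\<not> b). prim0 b f x) = 0"
    unfolding prim0_def by (intro integral_minus_mean circle_int_integrable prim_circle_int assms)
qed

lemma bounded_mean_zero_prim0:
  "f \<in> bounded_mean_zero b \<Longrightarrow> prim0 b f \<in> bounded_mean_zero (\<not> b)"
  by (rule prim0_bounded_mean_zero, erule bounded_mean_zero_circle_int) (simp add: bounded_mean_zero_def)

lemma prim_diff_fun:
  assumes "loc_int b f" "loc_int b g" shows "prim b (\<lambda>x. f x - g x) x = prim b f x - prim b g x"
  using prim_add[OF assms(1) loc_int_cmult[OF assms(2), of "-1"]] prim_cmult[of b "-1" g] by simp

lemma prim0_diff:
  assumes f: "f \<in> bounded_mean_zero b" and g: "g \<in> bounded_mean_zero b"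
  shows "prim0 b (\<lambda>x. f x - g x) x = prim0 b f x - prim0 b g x"
proof -
  note ci = bounded_mean_zero_circle_int[OF f] bounded_mean_zero_circle_int[OF g]
  have p: "prim b (\<lambda>x. f x - g x) = (\<lambda>x. prim b f x - prim b g x)"
    using ci by (intro ext prim_diff_fun circle_int_loc_int) auto
  have "integrable (mu (\<not> b)) (prim b f)" "integrable (mu (\<not> b)) (prim b g)"
    using f g ci by (auto intro!: circle_int_integrable prim_circle_int simp: bounded_mean_zero_def)
  then show ?thesis by (simp add: prim0_def p mean_def diff_divide_distrib)
qed

lemma D_add_const: "D b (\<lambda>x. f x + c) F \<longleftrightarrow> D b f F"
  by (simp add: D_def strong_D_minus_def strong_D_plus_def)

lemma D_prim0:
  assumes "loc_int b f" "regulated b f" shows "D b (prim0 b f) f"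
  using D_prim[OF assms] D_add_const[of b "prim b f" "- mean (\<not> b) (prim b f)" f]
  by (simp add: prim0_def[abs_def])

lemma regulated_add_const:
  assumes "regulated b f" shows "regulated b (\<lambda>x. f x + c)"
proof -
  have "((\<lambda>x. f x + c) \<longlongrightarrow> l + c) F" if "(f \<longlongrightarrow> l) F" for l F
    using that by (intro tendsto_intros)
  with assms show ?thesis
    unfolding regulated_def cadlag_def caglad_def continuous_within by (cases b) (simp, blast)+
qed

lemma prim0_regulated: "loc_int b f \<Longrightarrow> regulated (\<not> b) (prim0 b f)"
  using regulated_add_const[OF prim_regulated[of b f], of "- mean (\<not> b) (prim b f)"] by (simp add: prim0_def[abs_def])

section \<open>Approximating step functions by primitives of step functions\<close>

definition arc_indicator :: "bool \<Rightarrow> real \<Rightarrow> real \<Rightarrow> real \<Rightarrow> real" where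
  "arc_indicator b x y t = indicator (half_open b x y) (frac t)"

text \<open>Arcs avoid the point \<open>0\<close>, so their indicators need no care at the cut.\<close>

inductive_set steps :: "bool \<Rightarrow> (real \<Rightarrow> real) set" for b where
  zero: "(\<lambda>t. 0) \<in> steps b"
| add: "f \<in> steps b \<Longrightarrow> 0 < x \<Longrightarrow> x < y \<Longrightarrow> y < 1 \<Longrightarrow> (\<lambda>t. f t + c * arc_indicator b x y t) \<in> steps b"

lemma arc_indicator_eq: "0 \<le> t \<Longrightarrow> t < 1 \<Longrightarrow> arc_indicator b x y t = indicator (half_open b x y) t"
  by (simp add: arc_indicator_def frac_eq[THEN iffD2])

text \<open>Seen by the integrator, the primitive of an arc is a ramp that is constant off the arc.\<close>

lemma prim_arc_indicator:
  assumes xy: "0 < x" "x < y" "y < 1" and t: "0 \<le> t" "t \<le> 1"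
  shows "prim b (arc_indicator b x y) t = Phi b (min t y) - Phi b (min t x)"
proof -
  have "indicator (half_open b 0 t) z *\<^sub>R arc_indicator b x y z = indicator (half_open b (min t x) (min t y)) z" for z
  proof (cases "z = 1")
    case True then show ?thesis using xy t by (auto simp: arc_indicator_def half_open_def)
  next
    case False
    show ?thesis
    proof (cases "z \<in> half_open b 0 t")
      case True
      then have "0 \<le> z" "z < 1" using half_open_bounds[OF True] False t by auto
      then have "arc_indicator b x y z = indicator (half_open b x y) z" by (rule arc_indicator_eq)
      then show ?thesis using True xy by (auto simp: half_open_def indicator_def)
    next
      case _: False
      then have "z \<notin> half_open b (min t x) (min t y)" using xy t by (auto simp: half_open_def)
      then show ?thesis using \<open>z \<notin> half_open b 0 t\<close> by simp
    qed
  qed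
  then have "prim b (arc_indicator b x y) t = measure (M b) (half_open b (min t x) (min t y))"
    using t emeasure_half_open[of "min t x" "min t y" b] xy by (simp add: prim_def set_lebesgue_integral_def)
  also have "\<dots> = Phi b (min t y) - Phi b (min t x)"
    using xy by (intro measure_half_open) simp
  finally show ?thesis .
qed

lemma arc_indicator_measurable [measurable]: "arc_indicator b x y \<in> borel_measurable borel"
  unfolding arc_indicator_def[abs_def] frac_def by measurable

lemma integral_arc_indicator:
  assumes "0 < x" "x < y" "y < 1"
  shows "(LINT t|mu b. arc_indicator b x y t) = Phi b y - Phi b x"
  using prim_arc_indicator[OF assms, where t = 1 and b = b] prim_1[of "arc_indicator b x y" b] assms by simp

lemma steps_bounded:
  "f \<in> steps b \<Longrightarrow> periodic1 f \<and> f \<in> borel_measurable borel \<and> (\<exists>K. \<forall>x. \<bar>f x\<bar> \<le> K)"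
proof (induction rule: steps.induct)
  case zero then show ?case by (auto simp: periodic1_def)
next
  case (add f x y c)
  then obtain K where K: "\<And>t. \<bar>f t\<bar> \<le> K" by blast
  have "\<bar>f t + c * arc_indicator b x y t\<bar> \<le> K + \<bar>c\<bar>" for t
    using K[of t] by (auto simp: arc_indicator_def split: split_indicator)
  moreover have "periodic1 (\<lambda>t. f t + c * arc_indicator b x y t)"
    using add by (simp add: periodic1_def arc_indicator_def frac_1_eq)
  ultimately show ?case using add by auto
qed

lemma steps_circle_int: "f \<in> steps b \<Longrightarrow> circle_int b' f"
  using steps_bounded bounded_circle_int by metis

lemma arc_indicator_steps:
  assumes "0 < x" "x < y" "y < 1" shows "arc_indicator b x y \<in> steps b"
  using steps.add[OF steps.zero assms, where b = b and c = 1] by simp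

lemma steps_add:
  assumes "f \<in> steps b" "g \<in> steps b" shows "(\<lambda>t. f t + g t) \<in> steps b"
  using assms(2)
proof (induction rule: steps.induct)
  case zero then show ?case using assms(1) by simp
next
  case (add g x y c)
  from steps.add[OF add.IH add.hyps(2-4), of c] show ?case by (simp add: add_ac)
qed

lemma steps_cmult: "f \<in> steps b \<Longrightarrow> (\<lambda>t. c * f t) \<in> steps b"
proof (induction rule: steps.induct)
  case zero then show ?case by (simp add: steps.zero)
next
  case (add g x y d)
  from steps.add[OF add.IH add.hyps(2-4), of "c * d"] show ?case by (simp add: algebra_simps)
qed

text \<open>The indicators of side \<open>\<not> b\<close> jump at \<open>a\<close> from the side on which the integrator \<open>Phi (\<not> b)\<close> is continuous.
  An interval ending there (\<open>d = a\<close>) or starting there (\<open>c = a\<close>) can thus have small measure for side \<open>\<not> b\<close>,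
  while a ramp of side \<open>b\<close> can still climb by \<open>1\<close> on it.\<close>

lemma short_interval_at:
  assumes a: "0 < a" "a < 1" and e: "e > 0"
  obtains c d where "0 < c" "c < d" "d < 1" "if b then d = a else c = a"
    "Phi (\<not> b) d - Phi (\<not> b) c < e"
proof (cases b)
  case True
  have "(V \<longlongrightarrow> V a) (at_left a)" using V_caglad by (simp add: caglad_def continuous_within)
  then have "\<forall>\<^sub>F y in at_left a. \<bar>V y - V a\<bar> < e"
    using e by (auto simp: tendsto_iff dist_real_def)
  moreover have "\<forall>\<^sub>F y in at_left a. y \<in> {0<..<a}" using a by (intro eventually_at_left_real)
  ultimately have "\<forall>\<^sub>F y in at_left a. 0 < y \<and> y < a \<and> V a - V y < e"
    by eventually_elim auto
  then obtain c where "0 < c" "c < a" "V a - V c < e"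
    using eventually_happens[of _ "at_left a"] trivial_limit_at_left_real by blast
  then show ?thesis using that[of c a] True a by (simp add: Phi_def)
next
  case False
  have "(W \<longlongrightarrow> W a) (at_right a)" using W_cadlag by (simp add: cadlag_def continuous_within)
  then have "\<forall>\<^sub>F y in at_right a. \<bar>W y - W a\<bar> < e"
    using e by (auto simp: tendsto_iff dist_real_def)
  moreover have "\<forall>\<^sub>F y in at_right a. y \<in> {a<..<1}" using a by (intro eventually_at_right_real)
  ultimately have "\<forall>\<^sub>F y in at_right a. a < y \<and> y < 1 \<and> W y - W a < e"
    by eventually_elim auto
  then obtain d where "a < d" "d < 1" "W d - W a < e"
    using eventually_happens[of _ "at_right a"] trivial_limit_at_right_real by blast
  then show ?thesis using that[of a d] False a by (simp add: Phi_def)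
qed

definition bump :: "bool \<Rightarrow> real \<Rightarrow> real \<Rightarrow> real \<Rightarrow> real" where
  "bump b c d t = inverse (Phi b d - Phi b c) * arc_indicator b c d t"

lemma bump_steps: "0 < c \<Longrightarrow> c < d \<Longrightarrow> d < 1 \<Longrightarrow> bump b c d \<in> steps b"
  unfolding bump_def[abs_def] by (intro steps_cmult arc_indicator_steps)

lemma integral_bump: "0 < c \<Longrightarrow> c < d \<Longrightarrow> d < 1 \<Longrightarrow> (LINT t|mu b. bump b c d t) = 1"
  using Phi_strict[of c d b] by (simp add: bump_def integral_arc_indicator)

text \<open>The primitive of a bump climbs from \<open>0\<close> to \<open>1\<close> between \<open>c\<close> and \<open>d\<close>, hence it differs from the jump at \<open>a\<close> only
  there and by at most \<open>1\<close>.\<close>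

lemma prim_bump_approx:
  assumes cd: "0 < c" "c < d" "d < 1" "if b then d = a else c = a" and t: "0 \<le> t" "t < 1"
  shows "\<bar>indicator (half_open (\<not> b) a 1) t - prim b (bump b c d) t\<bar> \<le> arc_indicator (\<not> b) c d t"
proof -
  have pos: "Phi b d - Phi b c > 0" using Phi_strict[of c d b] cd by simp
  have eq: "prim b (bump b c d) t = (Phi b (min t d) - Phi b (min t c)) / (Phi b d - Phi b c)"
    unfolding bump_def[abs_def] prim_cmult using prim_arc_indicator[OF cd(1-3) t(1) less_imp_le[OF t(2)], where b = b] by (simp add: field_simps)
  consider "t \<le> c" | "c < t" "t < d" | "d \<le> t" by linarith
  then show ?thesis
  proof cases
    case 1
    then have "prim b (bump b c d) t = 0" using eq cd by simp
    then show ?thesis using 1 cd t by (auto simp: half_open_def arc_indicator_eq indicator_def split: if_splits)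
  next
    case 2
    have "Phi b c \<le> Phi b t" "Phi b t \<le> Phi b d" using 2 by (auto intro: Phi_mono)
    then have "0 \<le> prim b (bump b c d) t \<and> prim b (bump b c d) t \<le> 1"
      using pos 2 unfolding eq by (simp add: min_def divide_le_eq)
    moreover have "arc_indicator (\<not> b) c d t = 1" using 2 t by (simp add: arc_indicator_eq half_open_def)
    ultimately show ?thesis by (auto split: split_indicator)
  next
    case 3
    then have "prim b (bump b c d) t = 1" using eq cd pos by (simp add: min_def)
    then show ?thesis using 3 cd t by (auto simp: half_open_def arc_indicator_eq indicator_def split: if_splits)
  qed
qed

text \<open>The indicator of an arc is a difference of two jumps, each replaced by the primitive of a bump.  The two bumps have
  integral \<open>1\<close> each, so their difference has mean zero.\<close>

lemma arc_indicator_approx: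
  assumes xy: "0 < x" "x < y" "y < 1" and e: "e > 0"
  shows "\<exists>g\<in>steps b. (LINT t|mu b. g t) = 0 \<and> (LINT t|mu (\<not> b). \<bar>arc_indicator (\<not> b) x y t - prim b g t\<bar>) \<le> e"
proof -
  obtain c d where cd: "0 < c" "c < d" "d < 1" "if b then d = x else c = x" "Phi (\<not> b) d - Phi (\<not> b) c < e / 2"
    using short_interval_at[of x "e / 2" b] xy e by auto
  obtain c' d' where cd': "0 < c'" "c' < d'" "d' < 1" "if b then d' = y else c' = y" "Phi (\<not> b) d' - Phi (\<not> b) c' < e / 2"
    using short_interval_at[of y "e / 2" b] xy e by auto
  define g where "g t = bump b c d t + (- 1) * bump b c' d' t" for t
  have B: "bump b c d \<in> steps b" "bump b c' d' \<in> steps b" using cd cd' by (auto intro: bump_steps)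
  have L: "loc_int b (bump b c d)" "loc_int b (bump b c' d')" using B by (auto intro: circle_int_loc_int steps_circle_int)
  have g: "g \<in> steps b" unfolding g_def[abs_def] by (intro steps_add steps_cmult B)
  have int: "integrable (mu b') f" if "f \<in> steps b''" for b' b'' f
    using that by (intro circle_int_integrable steps_circle_int)
  have mean: "(LINT t|mu b. g t) = 0"
    using int[OF B(1)] int[OF B(2)] cd cd' by (simp add: g_def integral_bump)
  have "prim b g t = prim b (bump b c d) t - prim b (bump b c' d') t" for t
    using prim_add[OF L(1) loc_int_cmult[OF L(2), of "-1"]] prim_cmult[of b "-1" "bump b c' d'"] by (simp add: g_def[abs_def])
  moreover have "arc_indicator (\<not> b) x y t = indicator (half_open (\<not> b) x 1) t - indicator (half_open (\<not> b) y 1) t" if "0 \<le> t" "t < 1" for t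
    using that xy by (auto simp: arc_indicator_eq half_open_def indicator_def)
  ultimately have le: "\<bar>arc_indicator (\<not> b) x y t - prim b g t\<bar> \<le> arc_indicator (\<not> b) c d t + arc_indicator (\<not> b) c' d' t" if "0 \<le> t" "t < 1" for t
    using prim_bump_approx[OF cd(1-4) that] prim_bump_approx[OF cd'(1-4) that] that by simp
  have "(LINT t|mu (\<not> b). \<bar>arc_indicator (\<not> b) x y t - prim b g t\<bar>) \<le> (LINT t|mu (\<not> b). arc_indicator (\<not> b) c d t + arc_indicator (\<not> b) c' d' t)"
  proof (rule integral_mono)
    show "integrable (mu (\<not> b)) (\<lambda>t. \<bar>arc_indicator (\<not> b) x y t - prim b g t\<bar>)"
      using int[OF arc_indicator_steps[OF xy]] circle_int_integrable[OF prim_circle_int[OF steps_circle_int[OF g] mean]]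
      by (intro integrable_abs Bochner_Integration.integrable_diff)
    show "integrable (mu (\<not> b)) (\<lambda>t. arc_indicator (\<not> b) c d t + arc_indicator (\<not> b) c' d' t)"
      using cd cd' by (intro Bochner_Integration.integrable_add int[OF arc_indicator_steps])
  qed (use le in auto)
  also have "\<dots> = (Phi (\<not> b) d - Phi (\<not> b) c) + (Phi (\<not> b) d' - Phi (\<not> b) c')"
    using cd cd' by (subst Bochner_Integration.integral_add) (auto intro: int arc_indicator_steps simp: integral_arc_indicator)
  finally show ?thesis using g mean cd(5) cd'(5) by (intro bexI[of _ g]) auto
qed

lemma steps_prim_approx:
  assumes "f \<in> steps (\<not> b)" "e > 0"
  shows "\<exists>g\<in>steps b. (LINT t|mu b. g t) = 0 \<and> (LINT t|mu (\<not> b). \<bar>f t - prim b g t\<bar>) \<le> e"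
  using assms
proof (induction arbitrary: e rule: steps.induct)
  case zero
  then show ?case by (intro bexI[of _ "\<lambda>t. 0"]) (auto intro: steps.zero simp: prim_const)
next
  case (add f x y c)
  obtain g where g: "g \<in> steps b" "(LINT t|mu b. g t) = 0" "(LINT t|mu (\<not> b). \<bar>f t - prim b g t\<bar>) \<le> e / 2"
    using add.IH[of "e / 2"] add.prems by auto
  have "e / (2 * (\<bar>c\<bar> + 1)) > 0" using add.prems by simp
  from arc_indicator_approx[OF add.hyps(2-4) this, of b] obtain h where h: "h \<in> steps b" "(LINT t|mu b. h t) = 0"
    "(LINT t|mu (\<not> b). \<bar>arc_indicator (\<not> b) x y t - prim b h t\<bar>) \<le> e / (2 * (\<bar>c\<bar> + 1))" by blast
  let ?k = "\<lambda>t. g t + c * h t"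
  have int: "integrable (mu b') f" if "f \<in> steps b''" for b' b'' f
    using that by (intro circle_int_integrable steps_circle_int)
  have intp: "integrable (mu (\<not> b)) (prim b g)" "integrable (mu (\<not> b)) (prim b h)"
    by (intro circle_int_integrable prim_circle_int steps_circle_int[of _ b] g h)+
  have pk: "prim b ?k t = prim b g t + c * prim b h t" for t
    using prim_add[of b g "\<lambda>t. c * h t"] g h by (simp add: prim_cmult circle_int_loc_int loc_int_cmult steps_circle_int)
  have le: "\<bar>f t + c * arc_indicator (\<not> b) x y t - prim b ?k t\<bar> \<le> \<bar>f t - prim b g t\<bar> + \<bar>c\<bar> * \<bar>arc_indicator (\<not> b) x y t - prim b h t\<bar>" for t
  proof -
    have "f t + c * arc_indicator (\<not> b) x y t - prim b ?k t = (f t - prim b g t) + c * (arc_indicator (\<not> b) x y t - prim b h t)"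
      unfolding pk by (simp add: algebra_simps)
    then show ?thesis by (metis abs_mult abs_triangle_ineq)
  qed
  have i1: "integrable (mu (\<not> b)) (\<lambda>t. \<bar>f t - prim b g t\<bar>)" "integrable (mu (\<not> b)) (\<lambda>t. \<bar>arc_indicator (\<not> b) x y t - prim b h t\<bar>)"
    using int[OF add.hyps(1)] int[OF arc_indicator_steps[OF add.hyps(2-4)]] intp by (auto intro!: integrable_abs)
  have i2: "integrable (mu (\<not> b)) (prim b ?k)"
    using intp by (simp add: ext[OF pk])
  have "(LINT t|mu (\<not> b). \<bar>f t + c * arc_indicator (\<not> b) x y t - prim b ?k t\<bar>) \<le>
      (LINT t|mu (\<not> b). \<bar>f t - prim b g t\<bar> + \<bar>c\<bar> * \<bar>arc_indicator (\<not> b) x y t - prim b h t\<bar>)"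
    using int[OF add.hyps(1)] int[OF arc_indicator_steps[OF add.hyps(2-4)]] i1 i2 intp le
    by (intro integral_mono integrable_abs Bochner_Integration.integrable_add Bochner_Integration.integrable_diff) auto
  also have "\<dots> = (LINT t|mu (\<not> b). \<bar>f t - prim b g t\<bar>) + \<bar>c\<bar> * (LINT t|mu (\<not> b). \<bar>arc_indicator (\<not> b) x y t - prim b h t\<bar>)"
    using i1 by simp
  also have "\<dots> \<le> e / 2 + \<bar>c\<bar> * (e / (2 * (\<bar>c\<bar> + 1)))"
    by (intro add_mono g h mult_left_mono) auto
  also have "\<bar>c\<bar> * (e / (2 * (\<bar>c\<bar> + 1))) \<le> e / 2"
    using add.prems by (simp add: field_simps)
  finally have "(LINT t|mu (\<not> b). \<bar>f t + c * arc_indicator (\<not> b) x y t - prim b ?k t\<bar>) \<le> e" by simp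
  moreover have "(LINT t|mu b. ?k t) = 0" using int[OF g(1)] int[OF h(1)] g h by simp
  moreover have "?k \<in> steps b" by (intro steps_add steps_cmult g h)
  ultimately show ?case by (intro bexI[of _ ?k]) auto
qed

definition mean_zero_steps :: "bool \<Rightarrow> (real \<Rightarrow> real) set" where
  "mean_zero_steps b = {f \<in> steps b. (LINT t|mu b. f t) = 0}"

lemma mean_zero_steps_bounded: "f \<in> mean_zero_steps b \<Longrightarrow> f \<in> bounded_mean_zero b"
  using steps_bounded by (auto simp: mean_zero_steps_def bounded_mean_zero_def)

text \<open>Passing from \<open>prim\<close> to \<open>prim0\<close> costs as much again: \<open>f\<close> has mean zero, so the mean of \<open>prim b g\<close> is
  controlled by the distance between the two.\<close>

theorem steps_prim0_approx:
  assumes f: "f \<in> mean_zero_steps (\<not> b)" and e: "e > 0"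
  shows "\<exists>g\<in>mean_zero_steps b. (LINT t|mu (\<not> b). \<bar>f t - prim0 b g t\<bar>) \<le> e"
proof -
  obtain g where g: "g \<in> steps b" "(LINT t|mu b. g t) = 0" "(LINT t|mu (\<not> b). \<bar>f t - prim b g t\<bar>) \<le> e / 2"
    using steps_prim_approx[of f b "e / 2"] f e by (auto simp: mean_zero_steps_def)
  interpret finite_measure "mu (\<not> b)" by (rule finite_measure_mu)
  have intf: "integrable (mu (\<not> b)) f"
    using f by (auto simp: mean_zero_steps_def intro: circle_int_integrable steps_circle_int)
  have intp: "integrable (mu (\<not> b)) (prim b g)"
    by (intro circle_int_integrable prim_circle_int steps_circle_int[of _ b] g)
  let ?m = "mean (\<not> b) (prim b g)" and ?T = "Phi (\<not> b) 1 - Phi (\<not> b) 0"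
  have "?m * ?T = (LINT t|mu (\<not> b). prim b g t - f t)"
    using f intf intp Phi_01[of "\<not> b"] by (simp add: mean_def mean_zero_steps_def)
  then have "\<bar>?m * ?T\<bar> \<le> (LINT t|mu (\<not> b). \<bar>prim b g t - f t\<bar>)" by (metis integral_abs_bound)
  also have "\<dots> \<le> e / 2" using g(3) by (simp add: abs_minus_commute)
  finally have m: "\<bar>?m\<bar> * ?T \<le> e / 2" using Phi_01[of "\<not> b"] by (simp add: abs_mult)
  have "(LINT t|mu (\<not> b). \<bar>f t - prim0 b g t\<bar>) \<le> (LINT t|mu (\<not> b). \<bar>f t - prim b g t\<bar> + \<bar>?m\<bar>)"
    using intf intp by (intro integral_mono) (auto simp: prim0_def)
  also have "\<dots> = (LINT t|mu (\<not> b). \<bar>f t - prim b g t\<bar>) + \<bar>?m\<bar> * ?T"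
    using intf intp by (simp add: integral_mu_const)
  also have "\<dots> \<le> e" using m g(3) by simp
  finally show ?thesis using g by (intro bexI[of _ g]) (auto simp: mean_zero_steps_def)
qed

section \<open>Infinitely differentiable test functions\<close>

lemma bounded_mean_zero_diff:
  assumes f: "f \<in> bounded_mean_zero b" and g: "g \<in> bounded_mean_zero b"
  shows "(\<lambda>x. f x - g x) \<in> bounded_mean_zero b"
proof -
  obtain K L where K: "\<And>x. \<bar>f x\<bar> \<le> K" "\<And>x. \<bar>g x\<bar> \<le> L"
    using f g by (auto simp: bounded_mean_zero_def)
  have "\<bar>f x - g x\<bar> \<le> K + L" for x using K(1)[of x] K(2)[of x] by linarith
  moreover have "integrable (mu b) f" "integrable (mu b) g"
    using f g by (auto intro: circle_int_integrable bounded_mean_zero_circle_int)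
  ultimately show ?thesis
    using f g by (auto simp: bounded_mean_zero_def periodic1_def)
qed

lemma prim0_diff_bound:
  assumes f: "f \<in> bounded_mean_zero b" and g: "g \<in> bounded_mean_zero b"
  shows "\<bar>prim0 b f x - prim0 b g x\<bar> \<le> 2 * (LINT y|mu b. \<bar>f y - g y\<bar>)"
proof -
  have d: "(\<lambda>x. f x - g x) \<in> bounded_mean_zero b" by (rule bounded_mean_zero_diff[OF f g])
  then have "\<bar>prim0 b (\<lambda>x. f x - g x) x\<bar> \<le> 2 * (LINT y|mu b. \<bar>f y - g y\<bar>)"
    by (intro prim0_bound bounded_mean_zero_circle_int[OF d]) (simp add: bounded_mean_zero_def)
  then show ?thesis by (simp add: prim0_diff[OF f g])
qed

lemma prim0_diff_bound_sup:
  assumes f: "f \<in> bounded_mean_zero b" and g: "g \<in> bounded_mean_zero b"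
    and "\<And>x. \<bar>f x - g x\<bar> \<le> K"
  shows "\<bar>prim0 b f x - prim0 b g x\<bar> \<le> 2 * (Phi b 1 - Phi b 0) * K"
proof -
  have "integrable (mu b) (\<lambda>x. f x - g x)"
    using bounded_mean_zero_diff[OF f g] by (intro circle_int_integrable bounded_mean_zero_circle_int)
  from integral_bound_const[OF this, of K] assms(3)
  have "(LINT y|mu b. \<bar>f y - g y\<bar>) \<le> K * (Phi b 1 - Phi b 0)" by blast
  with prim0_diff_bound[OF f g, of x] show ?thesis by (simp add: algebra_simps)
qed

lemma bounded_mean_zero_uniform_limit:
  assumes f: "\<And>n. f n \<in> bounded_mean_zero b" and le: "\<And>n x. \<bar>f n x - g x\<bar> \<le> d n" and d: "d \<longlonglongrightarrow> 0"
  shows "g \<in> bounded_mean_zero b"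
proof -
  have lim: "(\<lambda>n. f n x) \<longlonglongrightarrow> g x" for x
    by (rule Lim_null_comparison[THEN LIM_zero_cancel, OF _ d]) (use le in auto)
  have per: "periodic1 g"
    unfolding periodic1_def
  proof
    fix x
    have "f n (x + 1) = f n x" for n using f[of n] by (simp add: bounded_mean_zero_def periodic1_def)
    then show "g (x + 1) = g x" using LIMSEQ_unique[OF lim[of x]] lim[of "x + 1"] by simp
  qed
  have meas: "g \<in> borel_measurable borel"
    by (rule borel_measurable_LIMSEQ_real[where u = f]) (use lim f in \<open>auto simp: bounded_mean_zero_def\<close>)
  obtain K where K: "\<And>x. \<bar>f 0 x\<bar> \<le> K" using f[of 0] by (auto simp: bounded_mean_zero_def)
  have bd: "\<bar>g x\<bar> \<le> K + d 0" for x using K[of x] le[of 0 x] by linarith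
  have ig: "integrable (mu b) g" by (intro circle_int_integrable bounded_circle_int[OF per meas bd])
  have "\<bar>LINT x|mu b. g x\<bar> \<le> d n * (Phi b 1 - Phi b 0)" for n
  proof -
    have i: "integrable (mu b) (f n)" by (intro circle_int_integrable bounded_mean_zero_circle_int[OF f])
    have "\<bar>LINT x|mu b. g x\<bar> = \<bar>LINT x|mu b. f n x - g x\<bar>"
      using i ig f[of n] by (simp add: bounded_mean_zero_def)
    also have "\<dots> \<le> (LINT x|mu b. \<bar>f n x - g x\<bar>)" by (rule integral_abs_bound)
    also have "\<dots> \<le> d n * (Phi b 1 - Phi b 0)" using i ig le by (intro integral_bound_const) auto
    finally show ?thesis .
  qed
  moreover have "(\<lambda>n. d n * (Phi b 1 - Phi b 0)) \<longlonglongrightarrow> 0" using d by (rule tendsto_mult_left_zero)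
  ultimately have "\<bar>LINT x|mu b. g x\<bar> \<le> 0" by (intro LIMSEQ_le_const) auto
  then show ?thesis using per meas bd by (auto simp: bounded_mean_zero_def)
qed

text \<open>The side on which the \<open>k\<close>-th member of an alternating chain starting on side \<open>b\<close> lives.\<close>

definition side :: "bool \<Rightarrow> nat \<Rightarrow> bool" where
  "side b k = (if even k then b else \<not> b)"

lemma side_0 [simp]: "side b 0 = b" and side_Suc [simp]: "side b (Suc k) = (\<not> side b k)"
  by (auto simp: side_def)

text \<open>\<open>iterated_prim0 b S n k\<close> integrates \<open>S (k + n)\<close> successively \<open>n + 1\<close> times, ending one level above \<open>S k\<close>.\<close>

primrec iterated_prim0 :: "bool \<Rightarrow> (nat \<Rightarrow> real \<Rightarrow> real) \<Rightarrow> nat \<Rightarrow> nat \<Rightarrow> real \<Rightarrow> real" where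
  "iterated_prim0 b S 0 k = prim0 (side b k) (S k)"
| "iterated_prim0 b S (Suc n) k = prim0 (side b k) (iterated_prim0 b S n (Suc k))"

text \<open>Dependent choice along \<open>steps_prim0_approx\<close>; the tolerances may shrink as fast as needed.\<close>

lemma approximating_steps:
  assumes s: "s \<in> mean_zero_steps b" and eps: "\<And>n. eps n > 0"
  shows "\<exists>S. S 0 = s \<and> (\<forall>n. S n \<in> mean_zero_steps (side b n) \<and>
    (LINT t|mu (side b n). \<bar>S n t - prim0 (side b (Suc n)) (S (Suc n)) t\<bar>) \<le> eps n)"
proof -
  define P where "P n f \<longleftrightarrow> f \<in> mean_zero_steps (side b n) \<and> (n = 0 \<longrightarrow> f = s)" for n f
  define Q where "Q n f g \<longleftrightarrow> (LINT t|mu (side b n). \<bar>f t - prim0 (side b (Suc n)) g t\<bar>) \<le> eps n" for n f g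
  have "\<exists>S. \<forall>n. P n (S n) \<and> Q n (S n) (S (Suc n))"
  proof (rule dependent_nat_choice)
    show "\<exists>f. P 0 f" using s by (auto simp: P_def)
    fix f n assume "P n f"
    then have "f \<in> mean_zero_steps (\<not> (side b (Suc n)))" by (simp add: P_def)
    from steps_prim0_approx[OF this eps] show "\<exists>g. P (Suc n) g \<and> Q n f g"
      by (auto simp: P_def Q_def)
  qed
  then show ?thesis by (auto simp: P_def Q_def)
qed

text \<open>The constants: one integration enlarges uniform distances at most by the factor \<open>L\<close>, and \<open>L\<^sup>1\<close> distances turn into
  uniform ones with a factor \<open>2 \<le> L\<close>.  With tolerances \<open>e / (2 L)\<^sup>n\<^sup>+\<^sup>1\<close> the distance between the \<open>n\<close>-th and the
  next iterated primitive is at most \<open>e / 2\<^sup>n\<^sup>+\<^sup>1\<close> at every level, which sums to \<open>e\<close>.  Only boundedness, measurability and mean zero have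
  to survive the uniform limit; regularity and strong derivatives follow from \<open>\<chi>\<^sub>k\<close> being a primitive.\<close>

theorem smooth_approximation:
  assumes s: "s \<in> mean_zero_steps b" and e: "e > 0"
  shows "\<exists>chi. (\<forall>k. chi k \<in> bounded_mean_zero (\<not> side b k) \<and> regulated (\<not> side b k) (chi k) \<and>
      D (side b k) (chi k) (chi (Suc k))) \<and> (\<forall>x. \<bar>chi 0 x - prim0 b s x\<bar> \<le> e)"
proof -
  define L where "L = 2 * (1 + (Phi True 1 - Phi True 0) + (Phi False 1 - Phi False 0))"
  have L: "L \<ge> 2" "2 * (Phi c 1 - Phi c 0) \<le> L" for c
    using Phi_01[of True] Phi_01[of False] by (cases c; simp add: L_def)+
  define eps where "eps n = e / (2 * L) ^ Suc n" for n
  have eps_pos: "eps n > 0" for n using e L by (simp add: eps_def)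
  obtain S where S0: "S 0 = s" and S: "\<And>n. S n \<in> mean_zero_steps (side b n)"
    "\<And>n. (LINT t|mu (side b n). \<bar>S n t - prim0 (side b (Suc n)) (S (Suc n)) t\<bar>) \<le> eps n"
    using approximating_steps[of s b eps, OF s eps_pos] by blast
  define a where "a = iterated_prim0 b S"
  have a0: "a 0 k = prim0 (side b k) (S k)" and aSuc: "a (Suc n) k = prim0 (side b k) (a n (Suc k))" for n k
    by (simp_all add: a_def)
  have Sb: "S k \<in> bounded_mean_zero (side b k)" for k by (intro mean_zero_steps_bounded S)
  have ab: "a n k \<in> bounded_mean_zero (\<not> side b k)" for n k
  proof (induction n arbitrary: k)
    case 0 show ?case unfolding a0 by (intro bounded_mean_zero_prim0 Sb)
  next
    case (Suc n)
    have "a n (Suc k) \<in> bounded_mean_zero (side b k)" using Suc[of "Suc k"] by simp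
    then show ?case unfolding aSuc by (rule bounded_mean_zero_prim0)
  qed
  have ab': "a n (Suc k) \<in> bounded_mean_zero (side b k)" for n k using ab[of n "Suc k"] by simp
  have step: "\<bar>a n k x - a (Suc n) k x\<bar> \<le> L ^ Suc n * eps (n + k)" for n k x
  proof (induction n arbitrary: k x)
    case 0
    have "\<bar>a 0 k x - a (Suc 0) k x\<bar> \<le> 2 * eps k"
      using prim0_diff_bound[OF Sb ab', of k x 0] S(2)[of k] by (simp add: a0 aSuc)
    also have "\<dots> \<le> L * eps k" using L eps_pos[of k] by (intro mult_right_mono) auto
    finally show ?case by simp
  next
    case (Suc n)
    have "\<bar>a (Suc n) k x - a (Suc (Suc n)) k x\<bar> \<le>
        2 * (Phi (side b k) 1 - Phi (side b k) 0) * (L ^ Suc n * eps (n + Suc k))"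
      using Suc[of "Suc k"] unfolding aSuc[of _ k] by (intro prim0_diff_bound_sup ab')
    also have "\<dots> \<le> L * (L ^ Suc n * eps (n + Suc k))"
      using L(2)[of "side b k"] L(1) eps_pos[of "n + Suc k"] by (intro mult_right_mono) auto
    finally show ?case by simp
  qed
  have step_bound: "\<bar>a n k x - a (Suc n) k x\<bar> \<le> e * (1/2) ^ Suc n" for n k x
  proof -
    have "(2 * L) ^ Suc (n + k) = 2 ^ Suc n * L ^ Suc n * (2 * L) ^ k"
      by (simp add: power_add power_mult_distrib)
    then have "L ^ Suc n * eps (n + k) = e * (1/2) ^ Suc n / (2 * L) ^ k"
      using L(1) by (simp add: eps_def field_simps)
    also have "\<dots> \<le> e * (1/2) ^ Suc n / 1"
      using L(1) e by (intro divide_left_mono one_le_power) auto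
    finally show ?thesis using step[of n k x] by simp
  qed
  define chi where "chi k x = lim (\<lambda>n. a n k x)" for k x
  have lim: "(\<lambda>n. a n k x) \<longlonglongrightarrow> chi k x" and near: "\<bar>a n k x - chi k x\<bar> \<le> e * (1/2) ^ n" for n k x
    unfolding chi_def using geometric_Cauchy_limit[of "\<lambda>n. a n k x" e] step_bound by blast+
  have to0: "(\<lambda>n. e * (1/2) ^ n) \<longlonglongrightarrow> 0"
    by (intro tendsto_mult_right_zero LIMSEQ_realpow_zero) auto
  have chib: "chi k \<in> bounded_mean_zero (\<not> side b k)" for k
    using ab near to0 by (rule bounded_mean_zero_uniform_limit)
  have chib': "chi (Suc k) \<in> bounded_mean_zero (side b k)" for k using chib[of "Suc k"] by simp
  have chi_prim0: "chi k = prim0 (side b k) (chi (Suc k))" for k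
  proof
    fix x
    have "\<bar>a (Suc n) k x - prim0 (side b k) (chi (Suc k)) x\<bar> \<le> 2 * (Phi (side b k) 1 - Phi (side b k) 0) * (e * (1/2) ^ n)" for n
      unfolding aSuc by (intro prim0_diff_bound_sup ab' chib' near)
    moreover have "(\<lambda>n. 2 * (Phi (side b k) 1 - Phi (side b k) 0) * (e * (1/2) ^ n)) \<longlonglongrightarrow> 0"
      using to0 by (rule tendsto_mult_right_zero)
    ultimately have "(\<lambda>n. a (Suc n) k x - prim0 (side b k) (chi (Suc k)) x) \<longlonglongrightarrow> 0"
      by (intro Lim_null_comparison[of "\<lambda>n. a (Suc n) k x - prim0 (side b k) (chi (Suc k)) x"]) auto
    then have "(\<lambda>n. a (Suc n) k x) \<longlonglongrightarrow> prim0 (side b k) (chi (Suc k)) x" by (rule LIM_zero_cancel)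
    then show "chi k x = prim0 (side b k) (chi (Suc k)) x"
      using LIMSEQ_Suc[OF lim[of k x]] LIMSEQ_unique by blast
  qed
  have loc: "loc_int c (chi k)" for c k by (intro circle_int_loc_int bounded_mean_zero_circle_int[OF chib])
  have regulated: "regulated (\<not> side b k) (chi k)" for k
    unfolding chi_prim0[of k] by (intro prim0_regulated loc)
  have "D (side b k) (chi k) (chi (Suc k))" for k
    using D_prim0[of "side b k" "chi (Suc k)", OF loc] regulated[of "Suc k"] chi_prim0[of k] by simp
  moreover have "\<bar>chi 0 x - prim0 b s x\<bar> \<le> e" for x
    using near[of 0 0 x] by (simp add: a0 S0 abs_minus_commute)
  ultimately show ?thesis using chib regulated by blast
qed

section \<open>Weak derivatives and primitives\<close>

definition strong_class :: "bool \<Rightarrow> (real \<Rightarrow> real) set" where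
  "strong_class b = (if b then C1 W else C0 V)"

lemma strong_class_iff:
  "f \<in> strong_class b \<longleftrightarrow> periodic1 f \<and> regulated b f \<and> (LINT x|mu b. f x) = 0"
  by (auto simp: strong_class_def C0_def C1_def regulated_def mu_True mu_False)

text \<open>The functions against which a weak derivative of side \<open>b\<close> is tested; they live on side \<open>b\<close> and their strong derivatives on
  side \<open>\<not> b\<close>.\<close>

definition tests :: "bool \<Rightarrow> (real \<Rightarrow> real) set" where
  "tests b = (if b then Cinf_VW V W else Cinf_WV W V)"

definition weak_D :: "bool \<Rightarrow> (real \<Rightarrow> real) \<Rightarrow> (real \<Rightarrow> real) \<Rightarrow> bool" where
  "weak_D b = (if b then weak_D_minus W V else weak_D_plus W V)"

lemma weak_D_iff:
  "weak_D b f F \<longleftrightarrow> f \<in> L2 (mu (\<not> b)) \<and> F \<in> L2 (mu b) \<and>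
    (\<forall>g\<in>tests b. \<forall>G. D (\<not> b) g G \<longrightarrow> (LINT x|mu (\<not> b). f x * G x) = - (LINT x|mu b. F x * g x))"
  by (cases b) (simp_all add: weak_D_def weak_D_minus_def weak_D_plus_def tests_def D_def mu_True mu_False)

lemma side_Not: "side (\<not> b) k = (\<not> side b k)"
  by (simp add: side_def)

lemma chain_tests:
  assumes psi: "\<And>k. psi k \<in> strong_class (side b k)" "\<And>k. D (side (\<not> b) k) (psi k) (psi (Suc k))"
  shows "(\<lambda>x. c + psi 0 x) \<in> tests b"
proof -
  have alt: "alt_deriv (D (\<not> b)) (D b) n (psi 0) (psi n)" for n
  proof (induction n)
    case (Suc n)
    have "if even n then D (\<not> b) (psi n) (psi (Suc n)) else D b (psi n) (psi (Suc n))"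
      using psi(2)[of n] by (auto simp: side_def split: if_splits)
    with Suc show ?case by auto
  qed simp
  show ?thesis
  proof (cases b)
    case True
    have "psi 0 \<in> strong_class_VW V W n" for n
      using alt[of n] psi(1)[of 0] psi(1)[of n] True
      by (auto simp: strong_class_VW_def D_def strong_class_def side_def split: if_splits)
    then show ?thesis using True by (auto simp: tests_def Cinf_VW_def)
  next
    case False
    have "psi 0 \<in> strong_class_WV W V n" for n
      using alt[of n] psi(1)[of 0] psi(1)[of n] False
      by (auto simp: strong_class_WV_def D_def strong_class_def side_def split: if_splits)
    then show ?thesis using False by (auto simp: tests_def Cinf_WV_def)
  qed
qed

lemma one_tests: "(\<lambda>x. 1) \<in> tests b" and D_one: "D b (\<lambda>x. 1) (\<lambda>x. 0)"
proof -
  have "D c (\<lambda>x. 0) (\<lambda>x. 0)" for c by (simp add: D_def strong_D_minus_def strong_D_plus_def)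
  moreover have "(\<lambda>x. 0) \<in> strong_class c" for c
    by (auto simp: strong_class_iff periodic1_def regulated_def cadlag_def caglad_def)
  ultimately show "(\<lambda>x. 1) \<in> tests b"
    using chain_tests[of "\<lambda>k x. 0" b 1] by simp
  show "D b (\<lambda>x. 1) (\<lambda>x. 0)" by (simp add: D_def strong_D_minus_def strong_D_plus_def)
qed

lemma weak_D_mean_zero:
  assumes "weak_D b f F" shows "(LINT x|mu b. F x) = 0"
  using assms one_tests[of b] D_one[of "\<not> b"] unfolding weak_D_iff by fastforce

lemma L2_circle_int:
  assumes f: "f \<in> L2 (mu b)" shows "circle_int b f"
proof -
  interpret finite_measure "mu b" by (rule finite_measure_mu)
  have f': "periodic1 f" "f \<in> borel_measurable borel" "integrable (mu b) (\<lambda>x. (f x)\<^sup>2)" using f by (auto simp: L2_def)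
  have "integrable (mu b) f"
  proof (rule Bochner_Integration.integrable_bound)
    show "integrable (mu b) (\<lambda>x. 1 + (f x)\<^sup>2)" using f'(3) by simp
    show "f \<in> borel_measurable (mu b)" by (rule borel_measurable_mu[OF f'(2)])
    have "\<bar>f x\<bar> \<le> 1 + (f x)\<^sup>2" for x
      using zero_le_power2[of "\<bar>f x\<bar> - 1"] by (simp add: power2_diff)
    then show "AE x in mu b. norm (f x) \<le> norm (1 + (f x)\<^sup>2)" by simp
  qed
  then show ?thesis using f' by (simp add: circle_int_def)
qed

lemma integrable_mult_bounded:
  assumes f: "circle_int b f" and g: "g \<in> borel_measurable borel" "\<And>x. \<bar>g x\<bar> \<le> K"
  shows "integrable (mu b) (\<lambda>x. f x * g x)"
proof (rule Bochner_Integration.integrable_bound)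
  show "integrable (mu b) (\<lambda>x. K * f x)" using f by (simp add: circle_int_def)
  show "(\<lambda>x. f x * g x) \<in> borel_measurable (mu b)"
    using f g by (intro borel_measurable_mu borel_measurable_times) (auto simp: circle_int_def)
  have "\<bar>f x * g x\<bar> \<le> \<bar>K * f x\<bar>" for x
  proof -
    have "\<bar>g x\<bar> \<le> \<bar>K\<bar>" using g(2)[of x] by linarith
    then show ?thesis by (simp add: abs_mult mult.commute[of _ "\<bar>f x\<bar>"] mult_left_mono)
  qed
  then show "AE x in mu b. norm (f x * g x) \<le> norm (K * f x)" by simp
qed

text \<open>The densities \<open>\<bar>u\<bar> + u\<close> and \<open>\<bar>u\<bar>\<close> are nonnegative and give all half-open intervals the same finite mass,
  so they define the same measure.\<close>

lemma AE_zero_of_prim_zero: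
  assumes u: "loc_int b u" and zero: "\<And>x. prim b u x = 0"
  shows "AE x in M b. u x = 0"
proof -
  interpret sigma_finite_measure "M b" by (rule sigma_finite_M)
  have [measurable]: "u \<in> borel_measurable borel" using u by (rule loc_int_measurable)
  have abs: "set_integrable (M b) (half_open b x y) (\<lambda>t. \<bar>u t\<bar>)" for x y
    by (intro set_integrable_abs loc_int_half_open u)
  have em: "emeasure (density (M b) (\<lambda>t. ennreal (g t))) (half_open b x y) = ennreal (LINT t:half_open b x y|M b. g t)"
    if [measurable]: "g \<in> borel_measurable borel" and "set_integrable (M b) (half_open b x y) g" "\<And>t. 0 \<le> g t" for g x y
  proof -
    have "emeasure (density (M b) (\<lambda>t. ennreal (g t))) (half_open b x y) = (\<integral>\<^sup>+t. ennreal (g t) * indicator (half_open b x y) t \<partial>M b)"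
      by (subst emeasure_density) auto
    also have "\<dots> = (\<integral>\<^sup>+t. ennreal (indicator (half_open b x y) t *\<^sub>R g t) \<partial>M b)"
      by (intro nn_integral_cong) (auto split: split_indicator)
    also have "\<dots> = ennreal (LINT t:half_open b x y|M b. g t)"
      unfolding set_lebesgue_integral_def using that
      by (intro nn_integral_eq_integral) (auto simp: set_integrable_def)
    finally show ?thesis .
  qed
  have eq: "(LINT t:half_open b x y|M b. \<bar>u t\<bar> + u t) = (LINT t:half_open b x y|M b. \<bar>u t\<bar>)" if "x \<le> y" for x y
    using prim_diff[OF u that] zero abs[of x y] loc_int_half_open[OF u] by simp
  have "density (M b) (\<lambda>t. ennreal (\<bar>u t\<bar> + u t)) = density (M b) (\<lambda>t. ennreal \<bar>u t\<bar>)"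
  proof (rule measure_eqI_half_open[where b = b])
    fix x y :: real assume xy: "x \<le> y"
    have 1: "emeasure (density (M b) (\<lambda>t. ennreal (\<bar>u t\<bar> + u t))) (half_open b x y) = ennreal (LINT t:half_open b x y|M b. \<bar>u t\<bar> + u t)"
      by (intro em set_integral_add abs loc_int_half_open u) auto
    have 2: "emeasure (density (M b) (\<lambda>t. ennreal \<bar>u t\<bar>)) (half_open b x y) = ennreal (LINT t:half_open b x y|M b. \<bar>u t\<bar>)"
      by (intro em abs) auto
    show "emeasure (density (M b) (\<lambda>t. ennreal (\<bar>u t\<bar> + u t))) (half_open b x y) = emeasure (density (M b) (\<lambda>t. ennreal \<bar>u t\<bar>)) (half_open b x y)"
      unfolding 1 2 eq[OF xy] ..
    show "emeasure (density (M b) (\<lambda>t. ennreal (\<bar>u t\<bar> + u t))) (half_open b x y) \<noteq> \<infinity>"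
      unfolding 1 by simp
  qed simp_all
  then have "AE t in M b. ennreal (\<bar>u t\<bar> + u t) = ennreal \<bar>u t\<bar>"
    by (intro density_unique) auto
  then show ?thesis
    by eventually_elim (simp add: ennreal_inj)
qed

lemma AE_M_mu: "AE x in M b. P x \<Longrightarrow> AE x in mu b. P x"
  unfolding mu_def by (subst AE_restrict_space_iff) (auto elim: eventually_mono)

lemma integral_mult_arc_indicator:
  assumes U: "loc_int b U" and xy: "0 < x" "x < y" "y < 1"
  shows "(LINT t|mu b. U t * arc_indicator b x y t) = prim b U y - prim b U x"
proof -
  have "(LINT t|mu b. U t * arc_indicator b x y t) = (LINT t|mu b. indicator (half_open b x y) t *\<^sub>R U t)"
    by (intro Bochner_Integration.integral_cong refl) (simp add: arc_indicator_eq)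
  also have "\<dots> = (LINT t|M b. indicator {0..<1} t *\<^sub>R (indicator (half_open b x y) t *\<^sub>R U t))"
    unfolding mu_def by (intro integral_restrict_space) simp
  also have "(\<lambda>t. indicator {0..<1} t *\<^sub>R (indicator (half_open b x y) t *\<^sub>R U t)) = (\<lambda>t. indicator (half_open b x y) t *\<^sub>R U t)"
    using xy by (auto simp: half_open_def indicator_def fun_eq_iff)
  also have "(LINT t|M b. indicator (half_open b x y) t *\<^sub>R U t) = prim b U y - prim b U x"
    using prim_diff[OF U, of x y] xy by (simp add: set_lebesgue_integral_def)
  finally show ?thesis .
qed

lemma D_unique_of_constant_quotient:
  assumes der: "D b p U" and q: "\<And>x y. 0 < x \<Longrightarrow> x < y \<Longrightarrow> y < 1 \<Longrightarrow> p y - p x = q * (Phi b y - Phi b x)"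
    and a: "0 < a" "a < 1"
  shows "U a = q"
proof (cases b)
  case True
  have "((\<lambda>h. (p (a + h) - p a) / (W (a + h) - W a)) \<longlongrightarrow> U a) (at_left 0)"
    using der True by (simp add: D_def strong_D_minus_def)
  moreover have "\<forall>\<^sub>F h in at_left 0. (p (a + h) - p a) / (W (a + h) - W a) = q"
  proof -
    have "\<forall>\<^sub>F h in at_left 0. h \<in> {-a<..<0}" using a by (intro eventually_at_left_real) simp
    then show ?thesis
    proof eventually_elim
      case (elim h)
      then have "W (a + h) - W a < 0" using Phi_strict[of "a + h" a True] by (simp add: Phi_def)
      moreover have "p (a + h) - p a = q * (W (a + h) - W a)"
        using q[of "a + h" a] elim a True by (simp add: Phi_def algebra_simps)
      ultimately show ?case by simp
    qed
  qed
  ultimately have "((\<lambda>h. q) \<longlongrightarrow> U a) (at_left (0 :: real))" by (rule Lim_transform_eventually)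
  then show ?thesis by (simp add: tendsto_const_iff)
next
  case False
  have "((\<lambda>h. (p (a + h) - p a) / (V (a + h) - V a)) \<longlongrightarrow> U a) (at_right 0)"
    using der False by (simp add: D_def strong_D_plus_def)
  moreover have "\<forall>\<^sub>F h in at_right 0. (p (a + h) - p a) / (V (a + h) - V a) = q"
  proof -
    have "\<forall>\<^sub>F h in at_right 0. h \<in> {0<..<1 - a}" using a by (intro eventually_at_right_real) simp
    then show ?thesis
    proof eventually_elim
      case (elim h)
      then have "V (a + h) - V a > 0" using Phi_strict[of a "a + h" False] by (simp add: Phi_def)
      moreover have "p (a + h) - p a = q * (V (a + h) - V a)"
        using q[of a "a + h"] elim a False by (simp add: Phi_def)
      ultimately show ?case by simp
    qed
  qed
  ultimately have "((\<lambda>h. q) \<longlongrightarrow> U a) (at_right (0 :: real))" by (rule Lim_transform_eventually)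
  then show ?thesis by (simp add: tendsto_const_iff)
qed

text \<open>Integrating by parts, the primitive \<open>U\<close> of \<open>u\<close> is orthogonal to all step functions of mean zero, in particular to the
  difference of any two bumps.  So all averages of \<open>U\<close> over arcs agree; by differentiation \<open>U\<close> is constant on
  \<open>(0,1)\<close>.  The constant is \<open>0\<close> because \<open>U\<close> vanishes at \<open>0\<close> and is continuous there, where the integrators have no atom.\<close>

theorem orthogonal_to_prim0_steps:
  assumes u: "circle_int (\<not> b) u" and mean: "(LINT x|mu (\<not> b). u x) = 0"
    and orth: "\<And>s. s \<in> mean_zero_steps b \<Longrightarrow> (LINT x|mu (\<not> b). u x * prim0 b s x) = 0"
  shows "AE x in mu (\<not> b). u x = 0"
proof -
  define U where "U = prim (\<not> b) u"
  have Uper: "periodic1 U" unfolding U_def by (rule prim_periodic[OF u mean])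
  have Uci: "circle_int b U" unfolding U_def by (rule prim_circle_int[OF u mean])
  note Uloc = circle_int_loc_int[OF Uci]
  have Ureg: "regulated b U" using prim_regulated[OF circle_int_loc_int[OF u]] by (simp add: U_def)
  have Us: "(LINT x|mu b. U x * s x) = 0" if s: "s \<in> mean_zero_steps b" for s
  proof -
    have sci: "circle_int b s" and s0: "(LINT x|mu b. s x) = 0"
      using s steps_circle_int by (auto simp: mean_zero_steps_def)
    have "(LINT x|mu (\<not> b). prim b s x * u x) = (LINT x|mu (\<not> b). u x * prim0 b s x + mean (\<not> b) (prim b s) * u x)"
      by (simp add: prim0_def algebra_simps)
    also have "\<dots> = (LINT x|mu (\<not> b). u x * prim0 b s x) + mean (\<not> b) (prim b s) * (LINT x|mu (\<not> b). u x)"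
    proof (subst Bochner_Integration.integral_add)
      have "prim0 b s \<in> borel_measurable borel" "\<exists>K. \<forall>x. \<bar>prim0 b s x\<bar> \<le> K"
        using prim0_bounded_mean_zero[OF sci s0] by (auto simp: bounded_mean_zero_def)
      then show "integrable (mu (\<not> b)) (\<lambda>x. u x * prim0 b s x)" using integrable_mult_bounded[OF u] by blast
    qed (use u in \<open>auto simp: circle_int_def\<close>)
    also have "\<dots> = 0" using orth[OF s] mean by simp
    finally show ?thesis using integration_by_parts[OF sci u] s0 by (simp add: U_def)
  qed
  \<comment> \<open>Any fixed arc serves as the reference for the common average.\<close>
  define q where "q = (LINT x|mu b. U x * bump b (1/4) (1/2) x)"
  have "prim b U y - prim b U x = q * (Phi b y - Phi b x)" if xy: "0 < x" "x < y" "y < 1" for x y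
  proof -
    let ?s = "\<lambda>t. bump b x y t + (- 1) * bump b (1/4) (1/2) t"
    have st: "bump b x y \<in> steps b" "bump b (1/4) (1/2) \<in> steps b" using xy by (auto intro: bump_steps)
    have "integrable (mu b) (bump b x y)" "integrable (mu b) (bump b (1/4) (1/2))"
      using st by (auto intro: circle_int_integrable steps_circle_int)
    then have "(LINT t|mu b. ?s t) = 0" using xy by (simp add: integral_bump)
    moreover have "?s \<in> steps b" by (intro steps_add steps_cmult st)
    ultimately have "?s \<in> mean_zero_steps b" by (simp add: mean_zero_steps_def)
    then have "(LINT t|mu b. U t * ?s t) = 0" by (rule Us)
    moreover have "integrable (mu b) (\<lambda>t. U t * f t)" if "f \<in> steps b" for f
      using integrable_mult_bounded[OF Uci] steps_bounded[OF that] by blast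
    ultimately have "(LINT t|mu b. U t * bump b x y t) = q"
      using st by (simp add: q_def algebra_simps)
    also have "(LINT t|mu b. U t * bump b x y t) = inverse (Phi b y - Phi b x) * (LINT t|mu b. U t * arc_indicator b x y t)"
      unfolding bump_def by (subst integral_mult_right_zero[symmetric]) (simp add: mult_ac)
    finally show ?thesis
      using integral_mult_arc_indicator[OF Uloc xy] Phi_strict[OF xy(2), of b] by (simp add: field_simps)
  qed
  then have const: "U a = q" if "0 < a" "a < 1" for a
    using D_unique_of_constant_quotient[OF D_prim[OF Uloc Ureg]] that by blast
  have U0: "U 0 = 0" by (simp add: U_def)
  have "isCont U 0" unfolding U_def by (intro prim_isCont circle_int_loc_int u Phi_cont)
  then have "continuous (at_right 0) U" by (rule continuous_at_imp_continuous_at_within)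
  then have "(U \<longlongrightarrow> 0) (at_right 0)" using U0 by (simp add: continuous_within)
  moreover have "\<forall>\<^sub>F x in at_right 0. U x = q"
    using eventually_at_right_real[of 0 1] by (auto elim!: eventually_mono intro: const)
  ultimately have "((\<lambda>x. q) \<longlongrightarrow> 0) (at_right (0 :: real))" by (rule Lim_transform_eventually)
  then have "q = 0" by (simp add: tendsto_const_iff)
  have "U x = 0" for x
  proof (cases "frac x = 0")
    case True
    then have "U (frac x) = 0" using U0 by metis
    then show ?thesis unfolding periodic1_frac[OF Uper] .
  next
    case False
    then show ?thesis using periodic1_frac[OF Uper, of x] const[of "frac x"] frac_ge_0[of x] frac_lt_1[of x] \<open>q = 0\<close> by simp
  qed
  then show ?thesis
    unfolding U_def by (intro AE_M_mu AE_zero_of_prim_zero circle_int_loc_int u)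
qed

text \<open>Du Bois-Reymond's lemma in this setting.\<close>

theorem weak_D_representation:
  assumes w: "weak_D b f F"
  shows "\<exists>c. AE x in mu (\<not> b). f x = prim b F x + c"
proof -
  have f: "circle_int (\<not> b) f" and F: "circle_int b F" using w by (auto simp: weak_D_iff intro: L2_circle_int)
  have F0: "(LINT x|mu b. F x) = 0" by (rule weak_D_mean_zero[OF w])
  note p = prim_circle_int[OF F F0, of "\<not> b"]
  define m where "m = mean (\<not> b) (\<lambda>x. f x - prim b F x)"
  define u where "u x = f x - prim b F x - m" for x
  interpret finite_measure "mu (\<not> b)" by (rule finite_measure_mu)
  have u: "circle_int (\<not> b) u"
    using f p unfolding u_def[abs_def] by (auto simp: circle_int_def periodic1_def)
  have u0: "(LINT x|mu (\<not> b). u x) = 0"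
    unfolding u_def m_def using f p by (intro integral_minus_mean) (auto simp: circle_int_def)
  \<comment> \<open>For smooth \<open>chi 0\<close>, the weak derivative and integration by parts yield the same value.\<close>
  have smooth: "(LINT x|mu (\<not> b). u x * chi 0 x) = 0"
    if chi: "\<And>k. chi k \<in> bounded_mean_zero (\<not> side b k)" "\<And>k. regulated (\<not> side b k) (chi k)"
      "\<And>k. D (side b k) (chi k) (chi (Suc k))" for chi
  proof -
    have c0: "chi 0 \<in> bounded_mean_zero (\<not> b)" using chi(1)[of 0] by simp
    obtain K where K: "\<And>x. \<bar>chi 0 x\<bar> \<le> K" and meas: "chi 0 \<in> borel_measurable borel" and c00: "(LINT x|mu (\<not> b). chi 0 x) = 0"
      using c0 by (auto simp: bounded_mean_zero_def)
    have cci: "circle_int c (chi 0)" for c by (rule bounded_mean_zero_circle_int[OF c0])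
    \<comment> \<open>The test function is one integration above the chain \<open>chi\<close>, so that its derivative is \<open>chi 0\<close>.\<close>
    define g where "g = prim0 (\<not> b) (chi 0)"
    define psi where "psi k = (case k of 0 \<Rightarrow> g | Suc j \<Rightarrow> chi j)" for k
    have gb: "g \<in> bounded_mean_zero b" using bounded_mean_zero_prim0[OF c0] by (simp add: g_def)
    have Dg: "D (\<not> b) g (chi 0)"
      unfolding g_def using chi(2)[of 0] by (intro D_prim0 circle_int_loc_int cci) simp
    have "psi k \<in> strong_class (side b k)" for k
    proof (cases k)
      case 0
      have "regulated b g" unfolding g_def using prim0_regulated[OF circle_int_loc_int[OF cci, of "\<not> b"]] by simp
      then show ?thesis using 0 gb by (auto simp: psi_def strong_class_iff bounded_mean_zero_def)
    next
      case (Suc j)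
      then show ?thesis using chi(1,2)[of j] by (auto simp: psi_def strong_class_iff bounded_mean_zero_def)
    qed
    moreover have "D (side (\<not> b) k) (psi k) (psi (Suc k))" for k
      using Dg chi(3) by (cases k) (simp_all add: psi_def side_Not)
    ultimately have "(\<lambda>x. 0 + psi 0 x) \<in> tests b" by (rule chain_tests)
    then have "g \<in> tests b" by (simp add: psi_def)
    then have weak: "(LINT x|mu (\<not> b). f x * chi 0 x) = - (LINT x|mu b. F x * g x)"
      using w Dg by (auto simp: weak_D_iff)
    have "integrable (mu b) (\<lambda>x. F x * g x)"
      using gb integrable_mult_bounded[OF F] by (auto simp: bounded_mean_zero_def)
    then have "(LINT x|mu b. F x * g x + mean b (prim (\<not> b) (chi 0)) * F x) = (LINT x|mu b. F x * g x)"
      using F F0 by (subst Bochner_Integration.integral_add) (auto simp: circle_int_def)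
    then have "(LINT x|mu b. prim (\<not> b) (chi 0) x * F x) = (LINT x|mu b. F x * g x)"
      by (simp add: g_def prim0_def algebra_simps)
    then have parts: "(LINT x|mu (\<not> b). prim b F x * chi 0 x) = - (LINT x|mu b. F x * g x)"
      using integration_by_parts[OF F cci] F0 by simp
    have i: "integrable (mu (\<not> b)) (\<lambda>x. f x * chi 0 x)" "integrable (mu (\<not> b)) (\<lambda>x. prim b F x * chi 0 x)"
      "integrable (mu (\<not> b)) (\<lambda>x. m * chi 0 x)"
      using integrable_mult_bounded[OF f meas K] integrable_mult_bounded[OF p meas K] circle_int_integrable[OF cci] by auto
    have "(LINT x|mu (\<not> b). u x * chi 0 x) = (LINT x|mu (\<not> b). f x * chi 0 x - prim b F x * chi 0 x - m * chi 0 x)"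
      by (simp add: u_def left_diff_distrib)
    also have "\<dots> = (LINT x|mu (\<not> b). f x * chi 0 x) - (LINT x|mu (\<not> b). prim b F x * chi 0 x) - (LINT x|mu (\<not> b). m * chi 0 x)"
      using i by simp
    also have "\<dots> = 0" using weak parts c00 by simp
    finally show ?thesis .
  qed
  have orth: "(LINT x|mu (\<not> b). u x * prim0 b s x) = 0" if s: "s \<in> mean_zero_steps b" for s
  proof -
    let ?N = "LINT x|mu (\<not> b). \<bar>u x\<bar>"
    have le: "\<bar>LINT x|mu (\<not> b). u x * prim0 b s x\<bar> \<le> e * ?N" if e: "e > 0" for e
    proof -
      obtain chi where chi: "\<And>k. chi k \<in> bounded_mean_zero (\<not> side b k)" "\<And>k. regulated (\<not> side b k) (chi k)"
        "\<And>k. D (side b k) (chi k) (chi (Suc k))" and near: "\<And>x. \<bar>chi 0 x - prim0 b s x\<bar> \<le> e"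
        using smooth_approximation[OF s e] by blast
      have as: "prim0 b s \<in> bounded_mean_zero (\<not> b)" by (intro bounded_mean_zero_prim0 mean_zero_steps_bounded s)
      have i: "integrable (mu (\<not> b)) (\<lambda>x. u x * prim0 b s x)" "integrable (mu (\<not> b)) (\<lambda>x. u x * chi 0 x)"
        using as chi(1)[of 0] integrable_mult_bounded[OF u] by (auto simp: bounded_mean_zero_def)
      have "(LINT x|mu (\<not> b). u x * prim0 b s x) = (LINT x|mu (\<not> b). u x * prim0 b s x - u x * chi 0 x)"
        using i smooth[of chi] chi by simp
      then have "\<bar>LINT x|mu (\<not> b). u x * prim0 b s x\<bar> = \<bar>LINT x|mu (\<not> b). u x * prim0 b s x - u x * chi 0 x\<bar>"
        by (rule arg_cong)
      also have "\<dots> \<le> (LINT x|mu (\<not> b). \<bar>u x * prim0 b s x - u x * chi 0 x\<bar>)" by (rule integral_abs_bound)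
      also have "\<dots> \<le> (LINT x|mu (\<not> b). e * \<bar>u x\<bar>)"
      proof (rule integral_mono)
        fix x :: real
        have "\<bar>u x * prim0 b s x - u x * chi 0 x\<bar> = \<bar>u x\<bar> * \<bar>chi 0 x - prim0 b s x\<bar>"
          by (metis abs_minus_commute abs_mult right_diff_distrib)
        also have "\<dots> \<le> \<bar>u x\<bar> * e" by (intro mult_left_mono near) simp
        finally show "\<bar>u x * prim0 b s x - u x * chi 0 x\<bar> \<le> e * \<bar>u x\<bar>" by (simp add: mult.commute)
        show "integrable (mu (\<not> b)) (\<lambda>x. \<bar>u x * prim0 b s x - u x * chi 0 x\<bar>)"
          by (intro integrable_abs Bochner_Integration.integrable_diff i)
        show "integrable (mu (\<not> b)) (\<lambda>x. e * \<bar>u x\<bar>)"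
          by (intro integrable_mult_right integrable_abs circle_int_integrable u)
      qed
      finally show ?thesis by simp
    qed
    have N: "0 \<le> ?N" by (intro integral_nonneg_AE) simp
    have "\<bar>LINT x|mu (\<not> b). u x * prim0 b s x\<bar> \<le> 0"
    proof (rule field_le_epsilon)
      fix e :: real assume e: "e > 0"
      \<comment> \<open>The summand \<open>1\<close> avoids a division by zero when \<open>u\<close> vanishes.\<close>
      then have "\<bar>LINT x|mu (\<not> b). u x * prim0 b s x\<bar> \<le> e / (?N + 1) * ?N" using N by (intro le divide_pos_pos) linarith+
      also have "\<dots> \<le> e / (?N + 1) * (?N + 1)" using N e by (intro mult_left_mono divide_nonneg_nonneg) linarith+
      also have "\<dots> = e"
      proof -
        have "?N + 1 \<noteq> 0" using N by linarith
        then show ?thesis by simp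
      qed
      finally show "\<bar>LINT x|mu (\<not> b). u x * prim0 b s x\<bar> \<le> 0 + e" by simp
    qed
    then show ?thesis by simp
  qed
  have "AE x in mu (\<not> b). u x = 0" by (rule orthogonal_to_prim0_steps[OF u u0 orth])
  then show ?thesis by (intro exI[of _ m]) (auto simp: u_def elim: eventually_mono)
qed

section \<open>From weak to strong derivatives\<close>

definition integrable_regulated :: "bool \<Rightarrow> (real \<Rightarrow> real) \<Rightarrow> bool" where
  "integrable_regulated b f \<longleftrightarrow> circle_int b f \<and> regulated b f"

lemma prim_integrable_regulated:
  assumes "circle_int b F" "(LINT x|mu b. F x) = 0"
  shows "integrable_regulated (\<not> b) (\<lambda>x. prim b F x + c)"
proof -
  interpret finite_measure "mu (\<not> b)" by (rule finite_measure_mu)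
  show ?thesis
    using prim_circle_int[OF assms, of "\<not> b"] regulated_add_const[OF prim_regulated[OF circle_int_loc_int[OF assms(1)]]]
    by (auto simp: integrable_regulated_def circle_int_def periodic1_def)
qed

lemma prim_cong_AE:
  assumes [measurable]: "F \<in> borel_measurable borel" "F' \<in> borel_measurable borel"
    and eq: "AE x in mu b. F x = F' x" and x: "0 \<le> x" "x < 1"
  shows "prim b F x = prim b F' x"
proof -
  have "(LINT y|mu b. indicator (half_open b 0 x) y * F y) = (LINT y|mu b. indicator (half_open b 0 x) y * F' y)"
    by (intro integral_cong_AE borel_measurable_mu) (use eq in auto)
  then show ?thesis using x by (simp add: prim_mu)
qed

text \<open>Once the last weak derivative \<open>F\<close> has a regulated version, the representation by primitives passes this property
  down the chain, and the fundamental theorem turns each weak derivative into a strong one.\<close>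

lemma strong_representative:
  assumes "alt_deriv (weak_D True) (weak_D False) n f F" "integrable_regulated (side False n) F'"
    "AE x in mu (side False n). F x = F' x"
  shows "\<exists>f'. alt_deriv (D True) (D False) n f' F' \<and> integrable_regulated False f' \<and> (AE x in mu False. f x = f' x)"
  using assms
proof (induction n arbitrary: F F')
  case 0
  then show ?case unfolding side_0 by (intro exI[of _ F']) simp
next
  case (Suc n)
  let ?b = "side True n"
  have b: "side False (Suc n) = ?b" "(\<not> ?b) = side False n" by (auto simp: side_def)
  obtain G where G: "alt_deriv (weak_D True) (weak_D False) n f G" and w: "weak_D ?b G F"
    using Suc.prems(1) by (auto simp: side_def split: if_splits)
  have F': "circle_int ?b F'" "regulated ?b F'" and eq: "AE x in mu ?b. F x = F' x"
    using Suc.prems(2,3) unfolding b by (auto simp: integrable_regulated_def)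
  have F: "circle_int ?b F" using w by (auto simp: weak_D_iff intro: L2_circle_int)
  have meas: "F \<in> borel_measurable borel" "F' \<in> borel_measurable borel" using F F' by (auto simp: circle_int_def)
  have "(LINT x|mu ?b. F' x) = (LINT x|mu ?b. F x)"
    by (intro integral_cong_AE borel_measurable_mu meas) (use eq in auto)
  then have F'0: "(LINT x|mu ?b. F' x) = 0" using weak_D_mean_zero[OF w] by simp
  obtain c where c: "AE x in mu (\<not> ?b). G x = prim ?b F x + c" using weak_D_representation[OF w] by blast
  let ?G = "\<lambda>x. prim ?b F' x + c"
  have "AE x in mu (\<not> ?b). G x = ?G x"
    using c AE_space by eventually_elim (use prim_cong_AE[OF meas eq] in simp)
  moreover have "integrable_regulated (\<not> ?b) ?G" by (rule prim_integrable_regulated[OF F'(1) F'0])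
  ultimately obtain f' where f': "alt_deriv (D True) (D False) n f' ?G" "integrable_regulated False f'" "AE x in mu False. f x = f' x"
    using Suc.IH[OF G, of ?G] unfolding b by blast
  have "D ?b ?G F'" unfolding D_add_const by (intro D_prim circle_int_loc_int F')
  then have "alt_deriv (D True) (D False) (Suc n) f' F'"
    using f'(1) by (auto simp: side_def split: if_splits)
  then show ?case using f' by blast
qed

lemma alt_deriv_add_const:
  "alt_deriv (D True) (D False) (Suc n) f F \<Longrightarrow> alt_deriv (D True) (D False) (Suc n) (\<lambda>x. f x + c) F"
proof (induction n arbitrary: F)
  case 0
  then show ?case using D_add_const[of True f c F] by simp
next
  case (Suc n)
  then obtain G where "alt_deriv (D True) (D False) (Suc n) f G" "if even (Suc n) then D True G F else D False G F"
    unfolding alt_deriv.simps(2)[of _ _ "Suc n"] by blast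
  with Suc.IH show ?case unfolding alt_deriv.simps(2)[of _ _ "Suc n"] by blast
qed

text \<open>The top weak derivative need not have a regulated version, so the descent starts one level below, where \<open>?G\<close> is a
  primitive of it.  For \<open>k = 1\<close> nothing is left to differentiate, and the discontinuities of a primitive against \<open>dW\<close> are
  among those of \<open>W\<close>.\<close>

theorem Hk_subset_Cn:
  assumes k: "k \<ge> 1" and f: "f \<in> Hk_WV W V k"
  shows "\<exists>g\<in>Cn_WV W V (k - 1). AE x in dV V. f x = g x"
proof -
  obtain m where m: "k = Suc m" using k by (cases k) auto
  let ?b = "side True m"
  have b: "(\<not> ?b) = side False m" by (auto simp: side_def)
  have "k \<in> {1..k}" using k by simp
  with f have "\<exists>F. alt_deriv (weak_D True) (weak_D False) k f F"
    unfolding Hk_WV_def weak_D_def if_True if_False by blast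
  then obtain F where "alt_deriv (weak_D True) (weak_D False) (Suc m) f F"
    unfolding m by blast
  then obtain G where G: "alt_deriv (weak_D True) (weak_D False) m f G" and w: "weak_D ?b G F"
    by (auto simp: side_def split: if_splits)
  have F: "circle_int ?b F" and F0: "(LINT x|mu ?b. F x) = 0"
    using w weak_D_mean_zero[OF w] by (auto simp: weak_D_iff intro: L2_circle_int)
  obtain c where c: "AE x in mu (\<not> ?b). G x = prim ?b F x + c" using weak_D_representation[OF w] by blast
  let ?G = "\<lambda>x. prim ?b F x + c"
  have rG: "integrable_regulated (side False m) ?G" using prim_integrable_regulated[OF F F0] unfolding b .
  obtain g where g: "alt_deriv (D True) (D False) m g ?G" "integrable_regulated False g" "AE x in mu False. f x = g x"
    using strong_representative[OF G rG] c unfolding b by blast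
  have "g \<in> Cn_WV W V m"
  proof (cases m)
    case 0
    have g': "g = (\<lambda>x. prim True F x + c)" using g(1) 0 by simp
    have "isCont g x" if "isCont W x" for x
      unfolding g' using prim_isCont[OF circle_int_loc_int[OF F], of x] that 0 by (simp add: Phi_def)
    then show ?thesis
      using 0 g(2) by (auto simp: Cn_WV_def integrable_regulated_def circle_int_def regulated_def discont_def)
  next
    case (Suc j)
    obtain H where "weak_D (side True j) H G"
      using G Suc by (cases "even j") (auto simp: side_def)
    moreover have "side True j = side False m" using Suc by (auto simp: side_def)
    ultimately have wG: "weak_D (side False m) H G" by simp
    then have G0: "(LINT x|mu (side False m). G x) = 0" by (rule weak_D_mean_zero)
    have Gm: "G \<in> borel_measurable borel" using wG by (simp add: weak_D_iff L2_def)
    have "(LINT x|mu (side False m). ?G x) = (LINT x|mu (side False m). G x)"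
    proof (intro integral_cong_AE borel_measurable_mu Gm)
      show "?G \<in> borel_measurable borel" using rG by (simp add: integrable_regulated_def circle_int_def)
      show "AE x in mu (side False m). ?G x = G x" using c unfolding b by (auto elim: eventually_mono)
    qed
    then have "?G \<in> strong_class (side False m)"
      using rG G0 by (simp add: strong_class_iff integrable_regulated_def circle_int_def)
    then have Gc: "?G \<in> (if odd m then C1 W else C0 V)"
      by (auto simp: strong_class_def side_def split: if_splits)
    let ?m = "mean False g"
    have "alt_deriv (D True) (D False) m (\<lambda>x. g x + - ?m) ?G"
      using g(1) alt_deriv_add_const[of j g ?G "- ?m"] Suc by blast
    moreover have "(\<lambda>x. g x + - ?m) \<in> strong_class False"
      using g(2) integral_minus_mean[of False g] regulated_add_const[of False g "- ?m"]
      by (simp add: strong_class_iff integrable_regulated_def circle_int_def periodic1_def)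
    ultimately have "(\<lambda>x. g x + - ?m) \<in> strong_class_WV W V m"
      using Gc by (auto simp: strong_class_WV_def D_def strong_class_def)
    moreover have "g = (\<lambda>x. ?m + (g x + - ?m))" by simp
    ultimately have "\<exists>c f. g = (\<lambda>x. c + f x) \<and> f \<in> strong_class_WV W V m"
      by (intro exI[of _ ?m] exI[of _ "\<lambda>x. g x + - ?m"]) simp
    then show ?thesis using Suc by (simp add: Cn_WV_def)
  qed
  then show ?thesis using g(3)[unfolded mu_False] m by auto
qed

end

theorem theorem25:
  fixes W V :: "real \<Rightarrow> real" and k :: nat
  assumes "strict_mono W" and "strict_mono V"
    and "cadlag W" and "caglad V"
    and "\<And>x. W (x + 1) - W x = W 1 - W 0"
    and "\<And>x. V (x + 1) - V x = V 1 - V 0"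
    and "isCont W 0" and "isCont V 0"
    and "W 0 = 0" and "V 0 = 0"
    and "k \<ge> 1"
  shows "\<forall>f\<in>Hk_WV W V k. \<exists>g\<in>Cn_WV W V (k - 1). AE x in dV V. f x = g x"
proof -
  interpret circle_pair W V by unfold_locales (fact assms)+
  show ?thesis using Hk_subset_Cn[OF \<open>k \<ge> 1\<close>] by blast
qed

end
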